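(* Let $T$ be a tree, i.e. a directed acyclic graph whose underlying undirected graph is a tree. Then the conditional independence statements implied by $T$ generate $I_T$, that is, $I_T = C_T$. In particular, $I_T$ is generated by linear polynomials of the form $\sigma_{ij}$ and quadratic tetrad polynomials $\sigma_{ij}\sigma_{kl}-\sigma_{il}\sigma_{jk}$.
   Context: Let $G$ be a directed acyclic graph (DAG) with vertex set $[n]=\{1,\dots,n\}$, numerically ordered: $i\to j\in E(G)$ only if $i<j$. A collider is a pair of edges $i\to k$, $j\to k$ with the same head. For vertices $i,j$, let $T(i,j)$ be the set of treks from $i$ to $j$: simple paths $P$ in (the underlying undirected graph of) $G$ from $i$ to $j$ containing no collider. Each trek goes from $i$ up to a topmost vertex $\mathrm{top}(P)$ and then down to $j$; $T(i,i)$ consists of the single empty trek, with top $i$. Let $\mathbb{C}[\Sigma]=\mathbb{C}[\sigma_{ij}\mid 1\le i\le j\le n]$ with $\sigma_{ij}=\sigma_{ji}$, and let $\phi_G:\mathbb{C}[\Sigma]\to\mathbb{C}[a_i,\lambda_{ij}\mid i\in[n],\ i\to j\in E(G)]$ be the ring homomorphism $\sigma_{ij}\mapsto\sum_{P\in T(i,j)}a_{\mathrm{top}(P)}\prod_{k\to l\in P}\lambda_{kl}$ (so $\sigma_{ii}\mapsto a_i$, and $\sigma_{ij}\mapsto 0$ if $T(i,j)=\emptyset$). Set $I_G=\ker\phi_G$. For disjoint $A,B,C\subseteq[n]$ ($C$ possibly empty), $C$ d-separates $A$ from $B$ in $G$ if every path in $G$ (ignoring edge directions) connecting a vertex $i\in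 A$ and a vertex $j\in B$ contains a vertex $k$ that is either (1) a non-collider on the path that belongs to $C$, or (2) a collider on the path (both path edges at $k$ point into $k$) that does not belong to $C$ and has no descendants belonging to $C$. Let $\Sigma$ be the symmetric $n\times n$ matrix with entries $\sigma_{ij}$, and $\Sigma_{R,S}$ its submatrix with rows $R$ and columns $S$. The conditional independence ideal is $$C_G=\langle (\#C+1)\text{-minors of }\Sigma_{A\cup C,B\cup C}\mid C\ \text{d-separates}\ A\ \text{from}\ B\ \text{in}\ G\rangle .$$ In tetrad polynomials the indices $i,j,k,l$ need not be distinct. *)

theory Defs
  imports
    "HOL-Library.Poly_Mapping"
    "HOL-Library.Uprod"
    "Jordan_Normal_Form.Determinant"
begin

section \<open>Polynomial rings over the complex numbers\<close>

text \<open>Polynomials whose variables are the elements of \<open>'x\<close>: finitely supported maps from monomials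
  (finitely supported exponent vectors) to coefficients.\<close>

type_synonym 'x cpoly = "('x \<Rightarrow>\<^sub>0 nat) \<Rightarrow>\<^sub>0 complex"

definition Const :: "complex \<Rightarrow> 'x cpoly" where
  "Const c = Poly_Mapping.single 0 c"

definition Var :: "'x \<Rightarrow> 'x cpoly" where
  "Var x = Poly_Mapping.single (Poly_Mapping.single x 1) 1"

definition monom_subst :: "('x \<Rightarrow> 'y cpoly) \<Rightarrow> ('x \<Rightarrow>\<^sub>0 nat) \<Rightarrow> 'y cpoly" where
  "monom_subst f m = (\<Prod>x\<in>Poly_Mapping.keys m. f x ^ Poly_Mapping.lookup m x)"

text \<open>The homomorphism of \<open>\<complex>\<close>-algebras sending the variable \<open>x\<close> to \<open>f x\<close>; see the lemmas
  \<open>poly_subst_Var\<close>, \<open>poly_subst_Const\<close>, \<open>poly_subst_add\<close>, \<open>poly_subst_mult\<close>.\<close>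

definition poly_subst :: "('x \<Rightarrow> 'y cpoly) \<Rightarrow> 'x cpoly \<Rightarrow> 'y cpoly" where
  "poly_subst f p =
     (\<Sum>m\<in>Poly_Mapping.keys p. Const (Poly_Mapping.lookup p m) * monom_subst f m)"

text \<open>The ideal generated by a set is its span in the ring regarded as a module over itself.\<close>

definition ideal_gen :: "'a::comm_ring_1 set \<Rightarrow> 'a set" where
  "ideal_gen S = module.span (*) S"


subsection \<open>Substitution is a ring homomorphism\<close>

lemma Const_0 [simp]: "Const 0 = 0"
  by (simp add: Const_def)

lemma Const_1 [simp]: "Const 1 = 1"
  by (simp add: Const_def)

lemma Const_add: "Const (a + b) = Const a + Const b"
  by (simp add: Const_def single_add)

lemma Const_mult: "Const (a * b) = Const a * Const b"
  by (simp add: Const_def mult_single)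

lemma monom_subst_0 [simp]: "monom_subst f 0 = 1"
  by (simp add: monom_subst_def)

lemma monom_subst_superset:
  assumes "finite X" "Poly_Mapping.keys m \<subseteq> X"
  shows "monom_subst f m = (\<Prod>x\<in>X. f x ^ Poly_Mapping.lookup m x)"
  unfolding monom_subst_def
  by (rule prod.mono_neutral_left) (use assms in \<open>auto simp: in_keys_iff\<close>)

lemma monom_subst_add: "monom_subst f (m + m') = monom_subst f m * monom_subst f m'"
proof -
  let ?X = "Poly_Mapping.keys m \<union> Poly_Mapping.keys m'"
  have "Poly_Mapping.keys (m + m') \<subseteq> ?X"
    by (rule Poly_Mapping.keys_add)
  then show ?thesis
    by (simp add: monom_subst_superset[of ?X] lookup_add power_add prod.distrib)
qed

lemma poly_subst_superset:
  assumes "finite M" "Poly_Mapping.keys p \<subseteq> M"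
  shows "poly_subst f p = (\<Sum>m\<in>M. Const (Poly_Mapping.lookup p m) * monom_subst f m)"
  unfolding poly_subst_def
  by (rule sum.mono_neutral_left) (use assms in \<open>auto simp: in_keys_iff\<close>)

lemma poly_subst_0 [simp]: "poly_subst f 0 = 0"
  by (simp add: poly_subst_def)

lemma poly_subst_add: "poly_subst f (p + q) = poly_subst f p + poly_subst f q"
proof -
  let ?M = "Poly_Mapping.keys p \<union> Poly_Mapping.keys q"
  have "Poly_Mapping.keys (p + q) \<subseteq> ?M"
    by (rule Poly_Mapping.keys_add)
  then show ?thesis
    by (simp add: poly_subst_superset[of ?M] lookup_add Const_add algebra_simps sum.distrib)
qed

lemma poly_subst_sum: "poly_subst f (sum g A) = (\<Sum>x\<in>A. poly_subst f (g x))"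
  by (induction A rule: infinite_finite_induct) (auto simp: poly_subst_add)

lemma poly_subst_single: "poly_subst f (Poly_Mapping.single m c) = Const c * monom_subst f m"
  by (simp add: poly_subst_superset[of "{m}"])

lemma poly_subst_Const: "poly_subst f (Const c) = Const c"
  by (simp add: Const_def poly_subst_single)

lemma poly_subst_1: "poly_subst f 1 = 1"
  using poly_subst_Const[of f 1] by simp

lemma poly_subst_Var: "poly_subst f (Var x) = f x"
  by (simp add: Var_def poly_subst_single monom_subst_def)

lemma cpoly_sum_monomials:
  fixes p :: "'x cpoly"
  shows "p = (\<Sum>m\<in>Poly_Mapping.keys p. Poly_Mapping.single m (Poly_Mapping.lookup p m))"
  by (rule poly_mapping_eqI)
     (simp add: lookup_sum lookup_single when_def in_keys_iff)

lemma poly_subst_mult: "poly_subst f (p * q) = poly_subst f p * poly_subst f q"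
proof -
  let ?s = "\<lambda>p m. Poly_Mapping.single m (Poly_Mapping.lookup p m)"
  have "p * q = (\<Sum>m\<in>Poly_Mapping.keys p. \<Sum>m'\<in>Poly_Mapping.keys q. ?s p m * ?s q m')"
    by (subst (1) cpoly_sum_monomials[of p], subst (1) cpoly_sum_monomials[of q])
       (simp add: sum_product)
  then show ?thesis
    by (simp add: poly_subst_sum mult_single poly_subst_single Const_mult monom_subst_add
        poly_subst_def[of f p] poly_subst_def[of f q] sum_product algebra_simps)
qed


section \<open>Paths and treks\<close>

text \<open>The vertex set \<open>[n]\<close> is a finite linearly ordered type \<open>'v\<close> (with \<open>n = CARD('v)\<close>), and a
  directed graph is its set of edges \<open>(i, j)\<close>, read \<open>i \<rightarrow> j\<close>. In a numerically ordered graph every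
  edge increases, so such a graph is automatically acyclic.\<close>

definition numerically_ordered :: "('v::linorder \<times> 'v) set \<Rightarrow> bool" where
  "numerically_ordered E \<longleftrightarrow> (\<forall>(i, j) \<in> E. i < j)"

definition adjacent :: "('v \<times> 'v) set \<Rightarrow> 'v \<Rightarrow> 'v \<Rightarrow> bool" where
  "adjacent E u v \<longleftrightarrow> (u, v) \<in> E \<or> (v, u) \<in> E"

text \<open>Simple paths of the underlying undirected graph, as lists of vertices.\<close>

definition simple_path :: "('v \<times> 'v) set \<Rightarrow> 'v \<Rightarrow> 'v list \<Rightarrow> 'v \<Rightarrow> bool" where
  "simple_path E i p j \<longleftrightarrow>
     p \<noteq> [] \<and> hd p = i \<and> last p = j \<and> distinct p \<and> successively (adjacent E) p"

definition undirected_cycle :: "('v \<times> 'v) set \<Rightarrow> 'v list \<Rightarrow> bool" where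
  "undirected_cycle E p \<longleftrightarrow>
     3 \<le> length p \<and> distinct p \<and> successively (adjacent E) p \<and> adjacent E (last p) (hd p)"

text \<open>The underlying undirected graph is a tree: connected and without cycles. (The predicate
  \<open>tree\<close> of the AFP entry \<open>Graph_Theory\<close> only excludes directed cycles.)\<close>

definition is_tree :: "('v \<times> 'v) set \<Rightarrow> bool" where
  "is_tree E \<longleftrightarrow> (\<forall>i j. \<exists>p. simple_path E i p j) \<and> (\<nexists>p. undirected_cycle E p)"

text \<open>Position \<open>m\<close> of the path \<open>p\<close> is a collider: both path edges at \<open>p ! m\<close> point into it.\<close>

definition collider_at :: "('v \<times> 'v) set \<Rightarrow> 'v list \<Rightarrow> nat \<Rightarrow> bool" where
  "collider_at E p m \<longleftrightarrow>
     0 < m \<and> Suc m < length p \<and> (p ! (m - 1), p ! m) \<in> E \<and> (p ! Suc m, p ! m) \<in> E"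

definition treks :: "('v \<times> 'v) set \<Rightarrow> 'v \<Rightarrow> 'v \<Rightarrow> 'v list set" where
  "treks E i j = {p. simple_path E i p j \<and> (\<forall>m. \<not> collider_at E p m)}"

definition path_edges :: "('v \<times> 'v) set \<Rightarrow> 'v list \<Rightarrow> ('v \<times> 'v) set" where
  "path_edges E p =
     {(k, l) \<in> E. \<exists>m. Suc m < length p \<and> (p ! m = k \<and> p ! Suc m = l \<or> p ! m = l \<and> p ! Suc m = k)}"

text \<open>The topmost vertex of a trek is its only vertex into which no edge of the trek points.\<close>

definition top_vertex :: "('v \<times> 'v) set \<Rightarrow> 'v list \<Rightarrow> 'v" where
  "top_vertex E p = (THE v. v \<in> set p \<and> (\<forall>u. (u, v) \<notin> path_edges E p))"


section \<open>The ideal of the graph\<close>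

text \<open>\<open>\<complex>[\<Sigma>]\<close> is \<open>'v uprod cpoly\<close>: its variables are the unordered pairs, so \<open>\<sigma> i j = \<sigma> j i\<close>.\<close>

definition \<sigma> :: "'v \<Rightarrow> 'v \<Rightarrow> 'v uprod cpoly" where
  "\<sigma> i j = Var (Upair i j)"

text \<open>The target ring has the variables \<open>a\<^sub>i\<close> and \<open>\<lambda>\<^sub>k\<^sub>l\<close>. Variables \<open>\<lambda>\<^sub>k\<^sub>l\<close> for non-edges are
  available in the type but never occur in the image of \<open>phi\<close>, so the kernel is not affected.\<close>

datatype 'v param = Avar 'v | Lvar 'v 'v

definition trek_poly :: "('v \<times> 'v) set \<Rightarrow> 'v \<Rightarrow> 'v \<Rightarrow> 'v param cpoly" where
  "trek_poly E i j =
     (\<Sum>p\<in>treks E i j. Var (Avar (top_vertex E p)) * (\<Prod>(k, l)\<in>path_edges E p. Var (Lvar k l)))"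

text \<open>Each variable is named \<open>\<sigma> i j\<close> for exactly one pair with \<open>i \<le> j\<close>. As treks may be reversed, the
  value on \<open>\<sigma> i j\<close> is \<open>trek_poly E i j\<close> irrespective of the order; see \<open>phi_\<sigma>\<close> below.\<close>

definition phi :: "('v::linorder \<times> 'v) set \<Rightarrow> 'v uprod cpoly \<Rightarrow> 'v param cpoly" where
  "phi E = poly_subst (\<lambda>s. trek_poly E (Min (set_uprod s)) (Max (set_uprod s)))"

definition trek_ideal :: "('v::linorder \<times> 'v) set \<Rightarrow> 'v uprod cpoly set" where
  "trek_ideal E = {f. phi E f = 0}"

lemma collider_at_rev:
  assumes "collider_at E p m"
  shows "collider_at E (rev p) (length p - Suc m)"
  using assms by (auto simp: collider_at_def rev_nth Suc_diff_Suc)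

lemma simple_path_rev: "simple_path E i p j \<Longrightarrow> simple_path E j (rev p) i"
  unfolding simple_path_def
  by (auto simp: hd_rev last_rev adjacent_def disj_commute)

lemma rev_in_treks:
  assumes "p \<in> treks E i j"
  shows "rev p \<in> treks E j i"
  using assms collider_at_rev[of E "rev p"] by (auto simp: treks_def simple_path_rev)

lemma path_edges_rev: "path_edges E (rev p) = path_edges E p"
proof -
  have "path_edges E p \<subseteq> path_edges E (rev p)" for p
  proof
    fix e assume "e \<in> path_edges E p"
    then obtain k l m where e: "e = (k, l)" "(k, l) \<in> E" "Suc m < length p"
      "p ! m = k \<and> p ! Suc m = l \<or> p ! m = l \<and> p ! Suc m = k"
      unfolding path_edges_def by blast
    let ?m = "length p - Suc (Suc m)"
    have "Suc ?m < length (rev p)" "rev p ! ?m = p ! Suc m" "rev p ! Suc ?m = p ! m"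
      using e by (auto simp: rev_nth Suc_diff_Suc)
    then show "e \<in> path_edges E (rev p)"
      unfolding path_edges_def using e by blast
  qed
  from this[of p] this[of "rev p"] show ?thesis by simp
qed

lemma trek_poly_commute: "trek_poly E i j = trek_poly E j i"
  unfolding trek_poly_def
  by (rule sum.reindex_bij_witness[of _ rev rev])
     (auto simp: rev_in_treks path_edges_rev top_vertex_def)

lemma phi_\<sigma>: "phi E (\<sigma> i j) = trek_poly E i j"
  by (cases "i \<le> j")
     (auto simp: phi_def \<sigma>_def poly_subst_Var min_def max_def trek_poly_commute)

lemma treks_self: "treks E i i = {[i]}"
proof -
  have "p = [i]" if "p \<in> treks E i i" for p
    using that by (cases p) (auto simp: treks_def simple_path_def split: if_splits)
  then show ?thesis
    by (auto simp: treks_def simple_path_def collider_at_def)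
qed

lemma phi_\<sigma>_self: "phi E (\<sigma> i i) = Var (Avar i)"
  by (simp add: phi_\<sigma> trek_poly_def treks_self path_edges_def top_vertex_def)


section \<open>The conditional independence ideal\<close>

text \<open>Paths are simple. \<open>E\<^sup>+\<close> relates a vertex to its proper descendants.\<close>

definition d_separates :: "('v \<times> 'v) set \<Rightarrow> 'v set \<Rightarrow> 'v set \<Rightarrow> 'v set \<Rightarrow> bool" where
  "d_separates E C A B \<longleftrightarrow>
     (\<forall>i\<in>A. \<forall>j\<in>B. \<forall>p. simple_path E i p j \<longrightarrow>
        (\<exists>m<length p.
            \<not> collider_at E p m \<and> p ! m \<in> C \<or>
            collider_at E p m \<and> p ! m \<notin> C \<and> (\<forall>d. (p ! m, d) \<in> E\<^sup>+ \<longrightarrow> d \<notin> C)))"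

text \<open>The minor of \<open>\<Sigma>\<close> with rows \<open>R\<close> and columns \<open>S\<close> (for \<open>card R = card S\<close>), both listed in
  increasing order.\<close>

definition minor :: "'v::linorder set \<Rightarrow> 'v set \<Rightarrow> 'v uprod cpoly" where
  "minor R S = det (mat (card R) (card S)
     (\<lambda>(r, s). \<sigma> (sorted_list_of_set R ! r) (sorted_list_of_set S ! s)))"

definition minors :: "nat \<Rightarrow> 'v::linorder set \<Rightarrow> 'v set \<Rightarrow> 'v uprod cpoly set" where
  "minors k R S = {minor R' S' | R' S'. R' \<subseteq> R \<and> S' \<subseteq> S \<and> card R' = k \<and> card S' = k}"

definition ci_ideal :: "('v::{finite,linorder} \<times> 'v) set \<Rightarrow> 'v uprod cpoly set" where
  "ci_ideal E = ideal_gen (\<Union>{minors (card C + 1) (A \<union> C) (B \<union> C) | A B C.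
     A \<inter> B = {} \<and> A \<inter> C = {} \<and> B \<inter> C = {} \<and> d_separates E C A B})"

definition tetrad :: "'v \<Rightarrow> 'v \<Rightarrow> 'v \<Rightarrow> 'v \<Rightarrow> 'v uprod cpoly" where
  "tetrad i j k l = \<sigma> i j * \<sigma> k l - \<sigma> i l * \<sigma> j k"

end

theory Submission
  imports Defs
begin

text \<open>Both ideals are compared with the ideal generated by the \<open>\<sigma>\<^sub>i\<^sub>j\<close> without trek and the tetrads
  that exchange the ends of two treks at a common vertex \<open>v\<close>. These generators are minors of
  d-separation statements with \<open>C = {}\<close> and \<open>C = {v}\<close>.

  Minors vanish under \<open>phi\<close>: writing \<open>a\<^sub>j\<close> as error variance plus the contribution of the parents
  gives \<open>\<sigma>\<^sub>i\<^sub>j = \<Sum>\<^sub>k \<omega>\<^sub>k W\<^sub>k\<^sub>i W\<^sub>k\<^sub>j\<close> with \<open>W\<close> the weights of directed paths. If \<open>C\<close> d-separates \<open>A\<close> from \<open>B\<close>,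
  then \<open>C\<close> splits into two parts such that every pair of directed paths from \<open>k\<close> to \<open>A \<union> C\<close> and
  \<open>B \<union> C\<close> meets the first part on the one path or the second part on the other. Cutting the paths
  there factors the matrix through a space of dimension \<open>card C\<close>, over any commutative ring.

  The kernel is generated by tetrads: in a tree \<open>phi\<close> sends each \<open>\<sigma>\<^sub>i\<^sub>j\<close> to a monomial or to \<open>0\<close>, so it
  suffices to connect two monomials with the same image. Their image records how often each vertex is
  left in each direction, and this allows to grow a trek of one monomial inside the other, vertex by
  vertex, by exchanges at the current vertex; then that trek is cancelled.\<close>

section \<open>Trek polynomials and directed path weights\<close>

text \<open>Both edges at an interior maximum would point into it and form a collider, so the
  largest vertex of a trek is an endpoint.\<close>

lemma trek_le:
  fixes E :: "('v::linorder \<times> 'v) set"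
  assumes "numerically_ordered E" "p \<in> treks E i j" "x \<in> set p"
  shows "x \<le> max i j"
proof -
  have p: "p \<noteq> []" "hd p = i" "last p = j" "distinct p" "successively (adjacent E) p"
      "\<And>m. \<not> collider_at E p m"
    using assms(2) by (auto simp: treks_def simple_path_def)
  define M where "M = Max (set p)"
  have "M \<in> set p" using p(1) by (simp add: M_def)
  then obtain m where m: "m < length p" "p ! m = M" by (auto simp: in_set_conv_nth)
  have up: "(u, M) \<in> E" if "adjacent E u M" "u \<in> set p" for u
  proof -
    have "u \<le> M" using that by (simp add: M_def)
    then show ?thesis using that assms(1) by (auto simp: adjacent_def numerically_ordered_def)
  qed
  have "m = 0 \<or> Suc m = length p"
  proof (rule ccontr)
    assume "\<not> ?thesis"
    then have m': "0 < m" "Suc m < length p" using m by auto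
    have "adjacent E (p ! (m - 1)) M" "adjacent E M (p ! Suc m)"
      using p(5) m m' successively_nth[of "adjacent E" p "m - 1"] successively_nth[of "adjacent E" p m]
      by auto
    then have "(p ! (m - 1), M) \<in> E" "(p ! Suc m, M) \<in> E"
      using up[of "p ! (m - 1)"] up[of "p ! Suc m"] m' by (simp_all add: adjacent_def disj_commute)
    then show False using p(6)[of m] m' m by (auto simp: collider_at_def)
  qed
  then have "M = i \<or> M = j"
  proof
    assume "Suc m = length p"
    then have "m = length p - 1" by simp
    then show ?thesis using m p by (simp add: last_conv_nth)
  qed (use m p in \<open>simp add: hd_conv_nth\<close>)
  moreover have "x \<le> M" using assms(3) by (simp add: M_def)
  ultimately show ?thesis by (auto simp: le_max_iff_disj)
qed

lemma collider_at_snoc: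
  assumes "p \<noteq> []"
  shows "(\<exists>m. collider_at E (p @ [x]) m) \<longleftrightarrow>
    (\<exists>m. collider_at E p m) \<or> collider_at E (p @ [x]) (length p - 1)"
proof -
  have "collider_at E (p @ [x]) m = collider_at E p m" if "m \<noteq> length p - 1" for m
    using that assms by (auto simp: collider_at_def nth_append)
  moreover have "\<not> collider_at E p (length p - 1)"
    using assms by (auto simp: collider_at_def)
  ultimately show ?thesis by metis
qed

lemma simple_path_snoc:
  assumes "p \<noteq> []"
  shows "simple_path E i (p @ [x]) y \<longleftrightarrow>
    x = y \<and> x \<notin> set p \<and> simple_path E i p (last p) \<and> adjacent E (last p) x"
  using assms by (auto simp: simple_path_def successively_append_iff)

lemma path_edges_snoc:
  assumes "p \<noteq> []"
  shows "path_edges E (p @ [x]) = path_edges E p \<union> (E \<inter> {(last p, x), (x, last p)})"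
proof -
  have "(k, l) \<in> path_edges E (p @ [x]) \<longleftrightarrow>
      (k, l) \<in> path_edges E p \<union> (E \<inter> {(last p, x), (x, last p)})" for k l
  proof -
    have "(\<exists>m. Suc m < length (p @ [x]) \<and> P ((p @ [x]) ! m) ((p @ [x]) ! Suc m)) \<longleftrightarrow>
        (\<exists>m. Suc m < length p \<and> P (p ! m) (p ! Suc m)) \<or> P (last p) x" for P
    proof -
      obtain n where n: "length p = Suc n" using assms by (cases p) auto
      have "(\<exists>m. Suc m < Suc (Suc n) \<and> Q m) \<longleftrightarrow> (\<exists>m. Suc m < Suc n \<and> Q m) \<or> Q n" for Q
        by (auto simp: less_Suc_eq)
      moreover have "(p @ [x]) ! n = last p" "(p @ [x]) ! Suc n = x"
        using n assms by (auto simp: nth_append last_conv_nth)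
      moreover have "Suc m < Suc n \<Longrightarrow> (p @ [x]) ! m = p ! m \<and> (p @ [x]) ! Suc m = p ! Suc m" for m
        using n by (simp add: nth_append)
      ultimately show ?thesis by (simp add: n) metis
    qed
    from this[of "\<lambda>a b. a = k \<and> b = l \<or> a = l \<and> b = k"]
    show ?thesis by (auto simp: path_edges_def)
  qed
  then show ?thesis by auto
qed

lemma path_edges_in_set: "(k, l) \<in> path_edges E p \<Longrightarrow> k \<in> set p \<and> l \<in> set p"
  by (auto simp: path_edges_def)

text \<open>The last vertex of a trek from \<open>i\<close> to \<open>j\<close> with \<open>i < j\<close> is entered from a parent, since a trek
  never climbs above its endpoints in the numerical order.\<close>

lemma treks_snoc:
  fixes E :: "('v::linorder \<times> 'v) set"
  assumes "numerically_ordered E" "i < j"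
  shows "treks E i j = (\<Union>u\<in>{u. (u, j) \<in> E}. (\<lambda>p. p @ [j]) ` treks E i u)"
proof (intro Set.set_eqI iffI)
  fix p assume p: "p \<in> treks E i j"
  then have "p \<noteq> []" "last p = j" by (auto simp: treks_def simple_path_def)
  then obtain q where q: "p = q @ [j]" by (metis append_butlast_last_id)
  have "q \<noteq> []" using p q assms(2) by (auto simp: treks_def simple_path_def)
  let ?u = "last q"
  have q': "simple_path E i q ?u" "j \<notin> set q" "adjacent E ?u j" "\<And>m. \<not> collider_at E q m"
    using p q \<open>q \<noteq> []\<close> simple_path_snoc[of q E i j j] collider_at_snoc[of q E j]
    by (auto simp: treks_def)
  have "?u \<le> max i j" by (rule trek_le[OF assms(1) p]) (simp add: q \<open>q \<noteq> []\<close>)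
  then have "(?u, j) \<in> E"
    using q'(3) assms by (auto simp: adjacent_def numerically_ordered_def)
  moreover have "q \<in> treks E i ?u" using q' by (simp add: treks_def)
  ultimately show "p \<in> (\<Union>u\<in>{u. (u, j) \<in> E}. (\<lambda>p. p @ [j]) ` treks E i u)" using q by blast
next
  fix p assume "p \<in> (\<Union>u\<in>{u. (u, j) \<in> E}. (\<lambda>p. p @ [j]) ` treks E i u)"
  then obtain u q where uq: "(u, j) \<in> E" "q \<in> treks E i u" "p = q @ [j]" by blast
  have "u < j" using uq(1) assms(1) by (auto simp: numerically_ordered_def)
  then have "j \<notin> set q" using trek_le[OF assms(1) uq(2), of j] assms(2) by (auto simp: le_max_iff_disj)
  have q: "q \<noteq> []" "last q = u" "simple_path E i q u" "\<And>m. \<not> collider_at E q m"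
    using uq(2) by (auto simp: treks_def simple_path_def)
  have "(j, u) \<notin> E" using \<open>u < j\<close> assms(1) by (auto simp: numerically_ordered_def)
  then have "\<not> collider_at E (q @ [j]) (length q - 1)"
    using q(1,2) by (auto simp: collider_at_def nth_append last_conv_nth)
  then show "p \<in> treks E i j"
    using uq q \<open>j \<notin> set q\<close> collider_at_snoc[of q E j] simple_path_snoc[of q E i j j]
    by (auto simp: treks_def adjacent_def)
qed

lemma finite_treks: "finite (treks E i j)" for i :: "'v::finite"
proof (rule finite_subset)
  show "treks E i j \<subseteq> {p. set p \<subseteq> UNIV \<and> length p \<le> card (UNIV :: 'v set)}"
    by (auto simp: treks_def simple_path_def) (metis card_mono distinct_card finite subset_UNIV)
  show "finite {p :: 'v list. set p \<subseteq> UNIV \<and> length p \<le> card (UNIV :: 'v set)}"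
    by (rule finite_lists_length_le) simp
qed

text \<open>The union in \<open>treks_snoc\<close> is disjoint because \<open>u\<close> is the last
  vertex of the shorter trek; appending \<open>j\<close> adds one edge and keeps the top.\<close>

lemma trek_poly_snoc:
  fixes E :: "('v::{finite,linorder} \<times> 'v) set"
  assumes "numerically_ordered E" "i < j"
  shows "trek_poly E i j = (\<Sum>u | (u, j) \<in> E. trek_poly E i u * Var (Lvar u j))"
proof -
  let ?w = "\<lambda>p. Var (Avar (top_vertex E p)) * (\<Prod>(k, l)\<in>path_edges E p. Var (Lvar k l))
    :: 'v param cpoly"
  have w: "?w (p @ [j]) = ?w p * Var (Lvar u j)" if u: "(u, j) \<in> E" and p: "p \<in> treks E i u" for u p
  proof -
    have p': "p \<noteq> []" "last p = u" using p by (auto simp: treks_def simple_path_def)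
    have "u < j" using u assms(1) by (auto simp: numerically_ordered_def)
    then have j: "j \<notin> set p" using trek_le[OF assms(1) p, of j] assms(2) by (auto simp: le_max_iff_disj)
    have "(j, u) \<notin> E" using \<open>u < j\<close> assms(1) by (auto simp: numerically_ordered_def)
    then have pe: "path_edges E (p @ [j]) = insert (u, j) (path_edges E p)"
      using path_edges_snoc[of p E j] p' u by auto
    have "(u, j) \<notin> path_edges E p" using j path_edges_in_set by fast
    moreover have "finite (path_edges E p)" by simp
    \<comment> \<open>The new edge enters only \<open>j\<close>: it rules out \<open>j\<close> as
      top and leaves the vertices of \<open>p\<close> unaffected.\<close>
    moreover have "top_vertex E (p @ [j]) = top_vertex E p"
      unfolding top_vertex_def pe using j by (intro arg_cong[where f = The] ext) auto
    ultimately show ?thesis by (simp add: pe mult_ac)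
  qed
  have "trek_poly E i j = (\<Sum>p\<in>(\<Union>u\<in>{u. (u, j) \<in> E}. (\<lambda>p. p @ [j]) ` treks E i u). ?w p)"
    unfolding trek_poly_def treks_snoc[OF assms] ..
  also have "\<dots> = (\<Sum>u | (u, j) \<in> E. \<Sum>p\<in>(\<lambda>p. p @ [j]) ` treks E i u. ?w p)"
  proof (rule sum.UNION_disjoint)
    show "\<forall>u\<in>{u. (u, j) \<in> E}. \<forall>v\<in>{u. (u, j) \<in> E}. u \<noteq> v \<longrightarrow>
        (\<lambda>p. p @ [j]) ` treks E i u \<inter> (\<lambda>p. p @ [j]) ` treks E i v = {}"
      by (auto simp: treks_def simple_path_def)
  qed (auto simp: finite_treks)
  also have "\<dots> = (\<Sum>u | (u, j) \<in> E. \<Sum>p\<in>treks E i u. ?w p * Var (Lvar u j))"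
    by (rule sum.cong[OF refl], subst sum.reindex) (auto simp: w inj_on_def intro!: sum.cong)
  finally show ?thesis by (simp add: trek_poly_def sum_distrib_right)
qed

text \<open>\<open>walk_weight E S k i\<close> is the generating function of the directed paths from \<open>k\<close> to \<open>i\<close> that
  avoid \<open>S\<close>. The guard \<open>u < i\<close> is there for termination only.\<close>

function walk_weight :: "('v::{finite,linorder} \<times> 'v) set \<Rightarrow> 'v set \<Rightarrow> 'v \<Rightarrow> 'v \<Rightarrow> 'v param cpoly"
  where
  "walk_weight E S k i = (if i \<in> S then 0 else (if k = i then 1 else 0) +
     (\<Sum>u | (u, i) \<in> E \<and> u < i. walk_weight E S k u * Var (Lvar u i)))"
  by auto
termination
  by (relation "measure (\<lambda>(E, S, k, i). card {..<i})")
     (auto intro!: psubset_card_mono simp: psubset_eq)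

declare walk_weight.simps [simp del]

lemma walk_weight_rec:
  fixes E :: "('v::{finite,linorder} \<times> 'v) set"
  assumes "numerically_ordered E"
  shows "walk_weight E S k i = (if i \<in> S then 0 else (if k = i then 1 else 0) +
     (\<Sum>u | (u, i) \<in> E. walk_weight E S k u * Var (Lvar u i)))"
proof -
  have "{u. (u, i) \<in> E \<and> u < i} = {u. (u, i) \<in> E}"
    using assms by (auto simp: numerically_ordered_def)
  then show ?thesis by (subst walk_weight.simps) simp
qed

lemma finite_linorder_induct [case_names less]:
  fixes i :: "'v::{finite,linorder}"
  assumes "\<And>i. (\<And>j. j < i \<Longrightarrow> P j) \<Longrightarrow> P i"
  shows "P i"
proof (induction i rule: measure_induct_rule[where f = "\<lambda>i. card {..<i}"])
  case (less i)
  have "card {..<j} < card {..<i}" if "j < i" for j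
    using that by (intro psubset_card_mono) auto
  then show ?case using less assms by blast
qed

lemma walk_weight_eq_0:
  fixes E :: "('v::{finite,linorder} \<times> 'v) set"
  assumes "i < k"
  shows "walk_weight E S k i = 0"
  using assms
proof (induction i rule: finite_linorder_induct)
  case (less i)
  then have "walk_weight E S k u = 0" if "u < i" for u
    using that by force
  then show ?case using less.prems by (subst walk_weight.simps) auto
qed

text \<open>The reflexive closure also relates a vertex of \<open>S\<close> to itself; the second
  conjunct excludes this, so the whole path avoids \<open>S\<close>.\<close>

lemma walk_weight_nonzero:
  fixes E :: "('v::{finite,linorder} \<times> 'v) set"
  assumes "walk_weight E S k i \<noteq> 0"
  shows "(k, i) \<in> (E \<inter> (- S) \<times> (- S))\<^sup>* \<and> i \<notin> S"
  using assms
proof (induction i rule: finite_linorder_induct)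
  case (less i)
  have i: "i \<notin> S" using less.prems by (subst (asm) walk_weight.simps) (auto split: if_splits)
  show ?case
  proof (cases "k = i")
    case False
    then have "(\<Sum>u | (u, i) \<in> E \<and> u < i. walk_weight E S k u * Var (Lvar u i)) \<noteq> 0"
      using less.prems i by (subst (asm) walk_weight.simps) simp
    then obtain u where u: "(u, i) \<in> E" "u < i" "walk_weight E S k u * Var (Lvar u i) \<noteq> 0"
      by (rule sum.not_neutral_contains_not_neutral) blast
    then have "walk_weight E S k u \<noteq> 0" by (metis mult_zero_left)
    with less.IH[OF u(2)] u(1) i show ?thesis
      by (auto intro: rtrancl_into_rtrancl)
  qed (use i in simp)
qed

text \<open>A directed path either avoids \<open>S\<close> or is split at its last vertex in \<open>S\<close>. By acyclicity the
  part after that vertex \<open>c\<close> is a path starting at \<open>c\<close> and avoiding \<open>S - {c}\<close>.\<close>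

lemma walk_weight_split:
  fixes E :: "('v::{finite,linorder} \<times> 'v) set"
  assumes "numerically_ordered E"
  shows "walk_weight E {} k i =
    (\<Sum>c\<in>S. walk_weight E {} k c * walk_weight E (S - {c}) c i) + walk_weight E S k i"
proof (induction i rule: finite_linorder_induct)
  case (less i)
  let ?W = "walk_weight E" and ?L = "\<lambda>u. Var (Lvar u i)"
  have lt: "u < i" if "(u, i) \<in> E" for u
    using that assms by (auto simp: numerically_ordered_def)
  show ?case
  proof (cases "i \<in> S")
    case True
    \<comment> \<open>Here \<open>i\<close> itself is the last vertex in \<open>S\<close>: only the
      summand \<open>c = i\<close> survives, with the trivial path as remainder.\<close>
    have "(\<Sum>u | (u, i) \<in> E. ?W (S - {i}) i u * ?L u) = 0"
      using lt by (intro sum.neutral) (auto simp: walk_weight_eq_0)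
    then have "?W (S - {i}) i i = 1"
      by (subst walk_weight_rec[OF assms]) simp
    moreover have "?W (S - {c}) c i = 0" if "c \<noteq> i" for c
      using that True by (subst walk_weight_rec[OF assms]) simp
    ultimately have "?W {} k c * ?W (S - {c}) c i = (if c = i then ?W {} k i else 0)" for c
      by simp
    moreover have "?W S k i = 0" using True by (subst walk_weight_rec[OF assms]) simp
    ultimately show ?thesis using True by simp
  next
    case False
    have c: "?W (S - {c}) c i = (\<Sum>u | (u, i) \<in> E. ?W (S - {c}) c u * ?L u)" if "c \<in> S" for c
      using that False by (subst walk_weight_rec[OF assms]) auto
    have "(\<Sum>c\<in>S. ?W {} k c * ?W (S - {c}) c i) =
        (\<Sum>c\<in>S. \<Sum>u | (u, i) \<in> E. ?W {} k c * ?W (S - {c}) c u * ?L u)"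
      by (intro sum.cong refl) (simp add: c sum_distrib_left mult.assoc)
    also have "\<dots> = (\<Sum>u | (u, i) \<in> E. \<Sum>c\<in>S. ?W {} k c * ?W (S - {c}) c u * ?L u)"
      by (rule sum.swap)
    also have "\<dots> = (\<Sum>u | (u, i) \<in> E. (?W {} k u - ?W S k u) * ?L u)"
      by (intro sum.cong refl, subst less[OF lt]) (auto simp: sum_distrib_right)
    finally show ?thesis
      using False
      by (subst (1 3) walk_weight_rec[OF assms]) (simp add: algebra_simps sum_subtractf)
  qed
qed

text \<open>The polynomial of the error variance \<open>\<omega>\<^sub>j\<close> of the Gaussian model, whose variances are the
  \<open>a\<^sub>j\<close>: the variance of vertex \<open>j\<close> that is not explained by its parents.\<close>

definition error_variance :: "('v::{finite,linorder} \<times> 'v) set \<Rightarrow> 'v \<Rightarrow> 'v param cpoly" where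
  "error_variance E j = Var (Avar j) -
     (\<Sum>u | (u, j) \<in> E. \<Sum>w | (w, j) \<in> E. trek_poly E u w * Var (Lvar w j) * Var (Lvar u j))"

text \<open>Induction on the larger index. Off the diagonal both sides obey the recursion of
  \<open>trek_poly_snoc\<close>; on the diagonal, applying \<open>Qrec\<close> twice leaves the
  double sum over parents that \<open>error_variance\<close> subtracts from
  \<open>a\<^sub>j\<close>.\<close>

lemma trek_poly_walk_weight:
  fixes E :: "('v::{finite,linorder} \<times> 'v) set"
  assumes "numerically_ordered E"
  shows "trek_poly E i j = (\<Sum>k\<in>UNIV. error_variance E k * walk_weight E {} k i * walk_weight E {} k j)"
    (is "_ = ?Q i j")
proof -
  let ?W = "walk_weight E {}" and ?\<omega> = "error_variance E"
  have Qc: "?Q i j = ?Q j i" for i j by (intro sum.cong refl) (simp add: mult_ac)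
  \<comment> \<open>Peel the last edge off the path to \<open>j\<close>; the trivial path
    contributes only for \<open>k = j\<close>.\<close>
  have Qrec: "?Q i j = ?\<omega> j * ?W j i + (\<Sum>u | (u, j) \<in> E. ?Q i u * Var (Lvar u j))" for i j
  proof -
    have "?Q i j = (\<Sum>k\<in>UNIV. (if k = j then ?\<omega> k * ?W k i else 0) +
        (\<Sum>u | (u, j) \<in> E. ?\<omega> k * ?W k i * ?W k u * Var (Lvar u j)))"
      by (intro sum.cong refl, subst (2) walk_weight_rec[OF assms])
         (simp add: algebra_simps sum_distrib_left)
    also have "\<dots> = ?\<omega> j * ?W j i +
        (\<Sum>k\<in>UNIV. \<Sum>u | (u, j) \<in> E. ?\<omega> k * ?W k i * ?W k u * Var (Lvar u j))"
      by (simp add: sum.distrib)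
    also have "(\<Sum>k\<in>UNIV. \<Sum>u | (u, j) \<in> E. ?\<omega> k * ?W k i * ?W k u * Var (Lvar u j)) =
        (\<Sum>u | (u, j) \<in> E. ?Q i u * Var (Lvar u j))"
      by (subst sum.swap) (simp add: sum_distrib_right)
    finally show ?thesis .
  qed
  have le: "trek_poly E i j = ?Q i j" if "i \<le> j" for i j
    using that
  proof (induction j arbitrary: i rule: finite_linorder_induct)
    case (less j)
    have IH: "trek_poly E i u = ?Q i u" if "i < j" "u < j" for i u
    proof (cases "i \<le> u")
      case False
      then show ?thesis using less.IH[of i u] that Qc[of u i] by (simp add: trek_poly_commute)
    qed (use less.IH that in blast)
    have lt: "u < j" if "(u, j) \<in> E" for u
      using that assms by (auto simp: numerically_ordered_def)
    show ?case
    proof (cases "i = j")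
      case True
      have "(\<Sum>u | (u, j) \<in> E. ?W j u * Var (Lvar u j)) = 0"
        using lt by (intro sum.neutral) (auto simp: walk_weight_eq_0)
      then have "?W j j = 1" by (subst walk_weight_rec[OF assms]) simp
      moreover have "?Q j u = (\<Sum>w | (w, j) \<in> E. trek_poly E u w * Var (Lvar w j))"
        if "(u, j) \<in> E" for u
      proof -
        have "?W j u = 0" using lt[OF that] by (rule walk_weight_eq_0)
        then have "?Q u j = (\<Sum>w | (w, j) \<in> E. ?Q u w * Var (Lvar w j))"
          using Qrec[of u j] by simp
        also have "\<dots> = (\<Sum>w | (w, j) \<in> E. trek_poly E u w * Var (Lvar w j))"
          using IH lt that by (intro sum.cong refl) simp
        finally show ?thesis using Qc[of j u] by simp
      qed
      ultimately have "?Q j j = Var (Avar j)"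
        using Qrec[of j j] by (simp add: error_variance_def sum_distrib_right)
      then show ?thesis using True phi_\<sigma>[of E j j] by (simp add: phi_\<sigma>_self)
    next
      case False
      then have "i < j" using less.prems by simp
      then show ?thesis
        using Qrec[of i j] IH lt trek_poly_snoc[OF assms \<open>i < j\<close>] by (simp add: walk_weight_eq_0)
    qed
  qed
  show ?thesis
  proof (cases "i \<le> j")
    case False
    then show ?thesis using le[of j i] Qc[of i j] by (simp add: trek_poly_commute)
  qed (rule le)
qed

section \<open>Conditional independence minors vanish\<close>

lemma numerically_ordered_asym:
  "numerically_ordered E \<Longrightarrow> (u, v) \<in> E \<Longrightarrow> (v, u) \<notin> E"
  unfolding numerically_ordered_def by (metis case_prodD less_asym)

section \<open>Active paths and reachability in a forest\<close>

definition enters :: "('v \<times> 'v) set \<Rightarrow> 'v list \<Rightarrow> bool" where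
  "enters E p \<longleftrightarrow> butlast p \<noteq> [] \<and> (last (butlast p), last p) \<in> E"

text \<open>The negation of the blocking condition on a collider in
  \<open>d_separates\<close>.\<close>

definition ancestor_of :: "('v \<times> 'v) set \<Rightarrow> 'v set \<Rightarrow> 'v \<Rightarrow> bool" where
  "ancestor_of E C x \<longleftrightarrow> x \<in> C \<or> (\<exists>d\<in>C. (x, d) \<in> E\<^sup>+)"

text \<open>The end of the path is exempt, because the next edge decides whether it is a collider;
  \<open>enters\<close> records what is needed to tell.\<close>

definition active :: "('v \<times> 'v) set \<Rightarrow> 'v set \<Rightarrow> 'v list \<Rightarrow> bool" where
  "active E C p \<longleftrightarrow> (\<forall>m. Suc m < length p \<longrightarrow>
     (if collider_at E p m then ancestor_of E C (p ! m) else p ! m \<notin> C))"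

lemma enters_snoc: "p \<noteq> [] \<Longrightarrow> enters E (p @ [y]) \<longleftrightarrow> (last p, y) \<in> E"
  by (simp add: enters_def)

lemma collider_at_last:
  assumes "p \<noteq> []"
  shows "collider_at E (p @ [y]) (length p - 1) \<longleftrightarrow> enters E p \<and> (y, last p) \<in> E"
proof -
  obtain q x where p: "p = q @ [x]" using assms by (metis append_butlast_last_id)
  show ?thesis
    by (cases q rule: rev_cases) (auto simp: p collider_at_def enters_def nth_append butlast_append)
qed

lemma active_snoc:
  assumes "p \<noteq> []"
  shows "active E C (p @ [y]) \<longleftrightarrow> active E C p \<and>
    (if enters E p \<and> (y, last p) \<in> E then ancestor_of E C (last p) else last p \<notin> C)"
proof -
  obtain n where n: "length p = Suc n" using assms by (cases p) auto
  have "(\<forall>m. Suc m < Suc (Suc n) \<longrightarrow> Q m) \<longleftrightarrow> (\<forall>m. Suc m < Suc n \<longrightarrow> Q m) \<and> Q n" for Q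
    by (auto simp: less_Suc_eq)
  moreover have "(p @ [y]) ! n = last p" using n assms by (simp add: nth_append last_conv_nth)
  moreover have "collider_at E (p @ [y]) n \<longleftrightarrow> enters E p \<and> (y, last p) \<in> E"
    using collider_at_last[OF assms, of E y] n by simp
  moreover have "collider_at E (p @ [y]) m = collider_at E p m \<and> (p @ [y]) ! m = p ! m"
    if "Suc m < Suc n" for m
    using that n by (auto simp: collider_at_def nth_append)
  ultimately show ?thesis unfolding active_def by (simp add: n)
qed

text \<open>If \<open>y\<close> is already on the path, the segment from \<open>y\<close> to
  \<open>x\<close> together with the edge back closes a cycle, unless \<open>y\<close> immediately
  precedes \<open>x\<close>.\<close>

lemma simple_path_step:
  fixes E :: "('v::linorder \<times> 'v) set"
  assumes "numerically_ordered E" "\<nexists>p. undirected_cycle E p" "simple_path E i p x" "adjacent E x y"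
  obtains "y \<notin> set p" "simple_path E i (p @ [y]) y"
  | q where "p = q @ [x]" "q \<noteq> []" "last q = y" "simple_path E i q y"
proof (cases "y \<in> set p")
  case False
  then show ?thesis
    using assms(3,4) simple_path_snoc[of p E i y y] that(1) by (auto simp: simple_path_def)
next
  case True
  have xy: "x \<noteq> y" using assms(1,4) by (auto simp: adjacent_def numerically_ordered_def)
  obtain as bs where p: "p = as @ y # bs" using True by (meson split_list)
  have bs: "bs \<noteq> []" "last bs = x" using assms(3) p xy by (auto simp: simple_path_def split: if_splits)
  have "length bs = 1"
  proof (rule ccontr)
    assume "length bs \<noteq> 1"
    then have "undirected_cycle E (y # bs)"
      using bs p assms(3,4)
      by (cases bs) (auto simp: undirected_cycle_def simple_path_def successively_append_iff Suc_le_eq)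
    then show False using assms(2) by blast
  qed
  then have "bs = [x]" using bs by (cases bs) auto
  then show ?thesis
    using that(2)[of "as @ [y]"] assms(3) simple_path_snoc[of "as @ [y]" E i x x] p by simp
qed

text \<open>Bayes-ball states: the vertices that a walk from \<open>a\<close> may reach when each collider is in \<open>C\<close>
  and no other interior vertex is. The last edge of a walk ending in \<open>up_reach\<close> points away from its
  end, that of a walk ending in \<open>down_reach\<close> points to its end. Such walks may backtrack.\<close>

inductive up_reach and down_reach for E :: "('v \<times> 'v) set" and C :: "'v set" and a :: 'v where
  start: "up_reach E C a a"
| up_up: "up_reach E C a x \<Longrightarrow> x \<notin> C \<Longrightarrow> (y, x) \<in> E \<Longrightarrow> up_reach E C a y"
| up_down: "up_reach E C a x \<Longrightarrow> x \<notin> C \<Longrightarrow> (x, y) \<in> E \<Longrightarrow> down_reach E C a y"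
| down_down: "down_reach E C a x \<Longrightarrow> x \<notin> C \<Longrightarrow> (x, y) \<in> E \<Longrightarrow> down_reach E C a y"
| down_up: "down_reach E C a x \<Longrightarrow> x \<in> C \<Longrightarrow> (y, x) \<in> E \<Longrightarrow> up_reach E C a y"

text \<open>The simple path is obtained from the walk by cancelling backtracking steps, which in a forest
  are the only obstruction to simplicity. Cancellation may change the direction of the last edge,
  which is what the alternatives in the two invariants account for.\<close>

lemma reach_active_path:
  fixes E :: "('v::linorder \<times> 'v) set"
  assumes "numerically_ordered E" "\<nexists>p. undirected_cycle E p"
  shows "up_reach E C a x \<Longrightarrow>
      \<exists>p. simple_path E a p x \<and> active E C p \<and> (enters E p \<longrightarrow> ancestor_of E C x)"
    and "down_reach E C a x \<Longrightarrow>
      \<exists>p. simple_path E a p x \<and> active E C p \<and> (enters E p \<or> x \<notin> C)"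
proof (induction rule: up_reach_down_reach.inducts)
  case start
  show ?case
    by (rule exI[of _ "[a]"]) (auto simp: simple_path_def active_def enters_def)
next
  case (up_up x y)
  then obtain p where p: "simple_path E a p x" "active E C p" "enters E p \<longrightarrow> ancestor_of E C x"
    by blast
  have pl: "p \<noteq> []" "last p = x" using p by (auto simp: simple_path_def)
  have xy: "(x, y) \<notin> E" using up_up numerically_ordered_asym[OF assms(1)] by blast
  have "adjacent E x y" using up_up by (simp add: adjacent_def)
  from assms p(1) this show ?case
  proof (cases rule: simple_path_step)
    case 1
    then show ?thesis
      using p pl up_up xy by (intro exI[of _ "p @ [y]"]) (auto simp: active_snoc enters_snoc)
  next
    case (2 q)
    have "ancestor_of E C x" using p 2 pl up_up enters_snoc[of q E x] by simp
    then have "ancestor_of E C y"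
      using up_up unfolding ancestor_of_def by (auto intro: trancl_into_trancl2)
    then show ?thesis using 2 p by (intro exI[of _ q]) (auto simp: active_snoc)
  qed
next
  case (up_down x y)
  then obtain p where p: "simple_path E a p x" "active E C p" "enters E p \<longrightarrow> ancestor_of E C x"
    by blast
  have pl: "p \<noteq> []" "last p = x" using p by (auto simp: simple_path_def)
  have yx: "(y, x) \<notin> E" using up_down numerically_ordered_asym[OF assms(1)] by blast
  have "adjacent E x y" using up_down by (simp add: adjacent_def)
  from assms p(1) this show ?case
  proof (cases rule: simple_path_step)
    case 1
    then show ?thesis
      using p pl up_down yx by (intro exI[of _ "p @ [y]"]) (auto simp: active_snoc enters_snoc)
  next
    case (2 q)
    then show ?thesis using p by (intro exI[of _ q]) (auto simp: active_snoc split: if_splits)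
  qed
next
  case (down_down x y)
  then obtain p where p: "simple_path E a p x" "active E C p" "enters E p \<or> x \<notin> C"
    by blast
  have pl: "p \<noteq> []" "last p = x" using p by (auto simp: simple_path_def)
  have yx: "(y, x) \<notin> E" using down_down numerically_ordered_asym[OF assms(1)] by blast
  have "adjacent E x y" using down_down by (simp add: adjacent_def)
  from assms p(1) this show ?case
  proof (cases rule: simple_path_step)
    case 1
    then show ?thesis
      using p pl down_down yx by (intro exI[of _ "p @ [y]"]) (auto simp: active_snoc enters_snoc)
  next
    case (2 q)
    then show ?thesis using p by (intro exI[of _ q]) (auto simp: active_snoc split: if_splits)
  qed
next
  case (down_up x y)
  then obtain p where p: "simple_path E a p x" "active E C p" "enters E p \<or> x \<notin> C"
    by blast
  have pl: "p \<noteq> []" "last p = x" using p by (auto simp: simple_path_def)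
  have anc: "ancestor_of E C x" "ancestor_of E C y"
    using down_up unfolding ancestor_of_def by (auto intro: trancl_into_trancl2)
  have "adjacent E x y" using down_up by (simp add: adjacent_def)
  from assms p(1) this show ?case
  proof (cases rule: simple_path_step)
    case 1
    then show ?thesis
      using p pl down_up anc by (intro exI[of _ "p @ [y]"]) (auto simp: active_snoc enters_snoc)
  next
    case (2 q)
    then show ?thesis using p anc by (intro exI[of _ q]) (auto simp: active_snoc split: if_splits)
  qed
qed

text \<open>An active path could be blocked only at its end \<open>b\<close>, which is neither a
  collider nor in \<open>C\<close>.\<close>

lemma d_separates_not_reach:
  fixes E :: "('v::linorder \<times> 'v) set"
  assumes "numerically_ordered E" "\<nexists>p. undirected_cycle E p" "d_separates E C A B"
    and "a \<in> A" "b \<in> B" "b \<notin> C"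
  shows "\<not> up_reach E C a b \<and> \<not> down_reach E C a b"
proof -
  have False if p: "simple_path E a p b" "active E C p" for p
  proof -
    from assms(3,4,5) p(1) obtain m where m: "m < length p"
      "\<not> collider_at E p m \<and> p ! m \<in> C \<or>
       collider_at E p m \<and> p ! m \<notin> C \<and> (\<forall>d. (p ! m, d) \<in> E\<^sup>+ \<longrightarrow> d \<notin> C)"
      unfolding d_separates_def by meson
    show False
    proof (cases "Suc m < length p")
      case True
      then show False
        using m(2) p(2) unfolding active_def ancestor_of_def by (auto split: if_splits)
    next
      case False
      then have "m = length p - 1" using m by simp
      then have "p ! m = b" using p(1) by (auto simp: simple_path_def last_conv_nth)
      then show False using m(2) False assms(6) by (auto simp: collider_at_def)
    qed
  qed
  then show ?thesis using reach_active_path[OF assms(1,2)] by blast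
qed

text \<open>\<open>D\<close> and \<open>C - D\<close> are the two sides of the trek separation that comes with a d-separation:
  a trek (with top \<open>k\<close>) must meet \<open>C - D\<close> on its way up or \<open>D\<close> on its way down.\<close>

lemma trek_separation:
  fixes E :: "('v::{finite,linorder} \<times> 'v) set"
  assumes "numerically_ordered E" "\<nexists>p. undirected_cycle E p" "d_separates E C A B"
    and "A \<inter> C = {}" "B \<inter> C = {}" "i \<in> A \<union> C" "j \<in> B \<union> C"
    and D: "D = {c \<in> C. \<exists>a\<in>A. down_reach E C a c}"
  shows "walk_weight E (C - D) k i * walk_weight E D k j = 0"
proof (rule ccontr)
  assume "\<not> ?thesis"
  then have "walk_weight E (C - D) k i \<noteq> 0" "walk_weight E D k j \<noteq> 0" by auto
  from this[THEN walk_weight_nonzero]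
  have ki: "(k, i) \<in> (E \<inter> (- (C - D)) \<times> (- (C - D)))\<^sup>*" "i \<notin> C - D"
    and kj: "(k, j) \<in> (E \<inter> (- D) \<times> (- D))\<^sup>*" "j \<notin> D" by auto
  \<comment> \<open>Climb from \<open>i\<close> to \<open>k\<close>. A vertex of \<open>C\<close> on
    the way lies in \<open>D\<close>, so some vertex of \<open>A\<close> reaches it downward and the
    walk may turn up there; the witness \<open>a\<close> can change at such a turn.\<close>
  have "k \<notin> C - D \<and> (\<exists>a\<in>A. up_reach E C a k \<or> k \<in> C \<and> down_reach E C a k)"
    using ki(1)
  proof (induction rule: converse_rtrancl_induct)
    case base
    show ?case using assms(6) ki(2) D by (auto intro: start)
  next
    case (step y x)
    then show ?case using D by (cases "x \<in> C") (auto intro: up_up down_up)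
  qed
  moreover have "k \<notin> D" using kj by (auto elim: converse_rtranclE)
  ultimately obtain a where a: "a \<in> A" "up_reach E C a k" "k \<notin> C" by blast
  \<comment> \<open>Descend from \<open>k\<close> to \<open>j\<close>: a vertex of \<open>C\<close>
    met here would be reached downward, hence lie in \<open>D\<close>, which this path
    avoids.\<close>
  have "j \<notin> C \<and> (up_reach E C a j \<or> down_reach E C a j)"
    using kj(1)
  proof (induction rule: rtrancl_induct)
    case (step y z)
    then have "down_reach E C a z" by (auto intro: up_down down_down)
    then show ?case using step a D by auto
  qed (use a in auto)
  then show False using d_separates_not_reach[OF assms(1-3) a(1)] assms(7) by blast
qed

text \<open>Over a commutative ring rank is replaced by multiplicativity of \<open>det\<close>: both
  factors are padded with zeros to square matrices, and column \<open>card C\<close> of the left one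
  vanishes.\<close>

lemma det_low_rank:
  fixes X :: "nat \<Rightarrow> 'c \<Rightarrow> 'a::comm_ring_1"
  assumes "finite C" "card C < m"
  shows "det (mat m m (\<lambda>(r, s). \<Sum>c\<in>C. X r c * Y c s)) = 0"
proof -
  obtain cs where cs: "set cs = C" "distinct cs" "length cs = card C"
    using finite_distinct_list[OF assms(1)] distinct_card by metis
  let ?X = "mat m m (\<lambda>(r, l). if l < card C then X r (cs ! l) else 0)"
  let ?Y = "mat m m (\<lambda>(l, s). if l < card C then Y (cs ! l) s else 0)"
  have "mat m m (\<lambda>(r, s). \<Sum>c\<in>C. X r c * Y c s) = ?X * ?Y"
  proof (rule eq_matI)
    fix r s assume rs: "r < dim_row (?X * ?Y)" "s < dim_col (?X * ?Y)"
    have "(\<Sum>c\<in>C. X r c * Y c s) = (\<Sum>l<card C. X r (cs ! l) * Y (cs ! l) s)"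
      using sum.reindex_bij_betw[OF bij_betw_nth[OF cs(2) refl refl], of "\<lambda>c. X r c * Y c s"] cs
      by simp
    also have "\<dots> = (\<Sum>l<m. (if l < card C then X r (cs ! l) else 0) *
        (if l < card C then Y (cs ! l) s else 0))"
      using assms(2) by (intro sum.mono_neutral_cong_left) auto
    finally show "mat m m (\<lambda>(r, s). \<Sum>c\<in>C. X r c * Y c s) $$ (r, s) = (?X * ?Y) $$ (r, s)"
      using rs by (simp add: scalar_prod_def lessThan_atLeast0)
  qed simp_all
  moreover have "det ?X = 0"
  proof -
    have "(\<Prod>j<m. if j < card C then X (p j) (cs ! j) else 0) = 0" for p
      using assms(2) by (intro prod_zero) (auto intro!: bexI[of _ "card C"])
    then show ?thesis by (subst det_col[of _ m]) auto
  qed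
  ultimately show ?thesis by (simp add: det_mult[of _ m])
qed

interpretation phi: comm_ring_hom "phi E"
  by unfold_locales (auto simp: phi_def poly_subst_add poly_subst_mult poly_subst_1)

lemma phi_minor_eq_0:
  fixes E :: "('v::{finite,linorder} \<times> 'v) set"
  assumes E: "numerically_ordered E" "\<nexists>p. undirected_cycle E p" and sep: "d_separates E C A B"
    and disj: "A \<inter> C = {}" "B \<inter> C = {}"
    and R: "R \<subseteq> A \<union> C" "card R = card C + 1" and S: "S \<subseteq> B \<union> C" "card S = card C + 1"
  shows "phi E (minor R S) = 0"
proof -
  define D where "D = {c \<in> C. \<exists>a\<in>A. down_reach E C a c}"
  let ?W = "walk_weight E" and ?\<omega> = "error_variance E"
  \<comment> \<open>Paths to \<open>i\<close> are cut at their last vertex in \<open>C - D\<close>;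
    if there is none, paths to \<open>j\<close> are cut at their last vertex in \<open>D\<close>.
    The sum over \<open>k\<close> goes into \<open>Y\<close> in the first case and into
    \<open>X\<close> in the second.\<close>
  define X where "X i c = (if c \<in> D then \<Sum>k\<in>UNIV. ?\<omega> k * ?W (C - D) k i * ?W {} k c
      else ?W (C - D - {c}) c i)" for i c
  define Y where "Y c j = (if c \<in> D then ?W (D - {c}) c j else trek_poly E c j)" for c j
  have "D \<subseteq> C" by (auto simp: D_def)
  have low_rank: "trek_poly E i j = (\<Sum>c\<in>C. X i c * Y c j)" if "i \<in> A \<union> C" "j \<in> B \<union> C" for i j
  proof -
    have sep: "?W (C - D) k i * ?W D k j = 0" for k
      using trek_separation[OF E sep disj that D_def] .
    have "trek_poly E i j = (\<Sum>k\<in>UNIV. ?\<omega> k * ?W {} k i * ?W {} k j)"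
      by (rule trek_poly_walk_weight[OF E(1)])
    also have "\<dots> = (\<Sum>k\<in>UNIV. \<Sum>c\<in>C - D. ?W (C - D - {c}) c i * (?\<omega> k * ?W {} k c * ?W {} k j)) +
        (\<Sum>k\<in>UNIV. ?\<omega> k * ?W (C - D) k i * ?W {} k j)"
      by (subst walk_weight_split[OF E(1), of _ i "C - D"])
         (simp add: algebra_simps sum.distrib sum_distrib_left)
    also have "(\<Sum>k\<in>UNIV. \<Sum>c\<in>C - D. ?W (C - D - {c}) c i * (?\<omega> k * ?W {} k c * ?W {} k j)) =
        (\<Sum>c\<in>C - D. X i c * Y c j)"
      by (subst sum.swap, intro sum.cong refl)
         (simp add: X_def Y_def trek_poly_walk_weight[OF E(1)] sum_distrib_left)
    also have "(\<Sum>k\<in>UNIV. ?\<omega> k * ?W (C - D) k i * ?W {} k j) =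
        (\<Sum>k\<in>UNIV. \<Sum>c\<in>D. ?\<omega> k * ?W (C - D) k i * ?W {} k c * ?W (D - {c}) c j)"
    proof (intro sum.cong refl)
      fix k
      have "?\<omega> k * ?W (C - D) k i * ?W {} k j =
          (\<Sum>c\<in>D. ?\<omega> k * ?W (C - D) k i * ?W {} k c * ?W (D - {c}) c j) +
          ?\<omega> k * (?W (C - D) k i * ?W D k j)"
        by (subst walk_weight_split[OF E(1), of k j D])
           (simp only: distrib_left sum_distrib_left mult.assoc)
      then show "?\<omega> k * ?W (C - D) k i * ?W {} k j =
          (\<Sum>c\<in>D. ?\<omega> k * ?W (C - D) k i * ?W {} k c * ?W (D - {c}) c j)"
        by (simp add: sep)
    qed
    also have "\<dots> = (\<Sum>c\<in>D. X i c * Y c j)"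
      by (subst sum.swap) (simp add: X_def Y_def sum_distrib_right)
    finally show ?thesis
      using \<open>D \<subseteq> C\<close> sum.subset_diff[of D C "\<lambda>c. X i c * Y c j"] by simp
  qed
  have nth: "sorted_list_of_set R ! r \<in> A \<union> C" "sorted_list_of_set S ! r \<in> B \<union> C"
    if "r < card C + 1" for r
    using that R S nth_mem[of r "sorted_list_of_set R"] nth_mem[of r "sorted_list_of_set S"]
    by auto
  have "phi E (minor R S) = det (map_mat (phi E) (mat (card R) (card S)
      (\<lambda>(r, s). \<sigma> (sorted_list_of_set R ! r) (sorted_list_of_set S ! s))))"
    by (simp add: minor_def phi.hom_det)
  also have "map_mat (phi E) (mat (card R) (card S)
      (\<lambda>(r, s). \<sigma> (sorted_list_of_set R ! r) (sorted_list_of_set S ! s))) =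
      mat (card C + 1) (card C + 1) (\<lambda>(r, s). \<Sum>c\<in>C.
        X (sorted_list_of_set R ! r) c * Y c (sorted_list_of_set S ! s))"
    using R(2) S(2) low_rank nth by (intro eq_matI) (auto simp: phi_\<sigma>)
  also have "det \<dots> = 0" by (rule det_low_rank) simp_all
  finally show ?thesis .
qed

lemma module_mult: "Modules.module ((*) :: 'a::comm_ring_1 \<Rightarrow> 'a \<Rightarrow> 'a)"
  by unfold_locales (simp_all add: algebra_simps)

lemma ideal_gen_subset_trek_ideal:
  assumes "S \<subseteq> trek_ideal E"
  shows "ideal_gen S \<subseteq> trek_ideal E"
  unfolding ideal_gen_def
proof (rule module.span_minimal[OF module_mult assms])
  show "module.subspace (*) (trek_ideal E)"
    by (rule module.subspaceI[OF module_mult])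
       (auto simp: trek_ideal_def phi.hom_add phi.hom_mult)
qed

lemma ci_ideal_subset_trek_ideal:
  assumes "numerically_ordered E" "\<nexists>p. undirected_cycle E p"
  shows "ci_ideal E \<subseteq> trek_ideal E"
  unfolding ci_ideal_def
  by (intro ideal_gen_subset_trek_ideal)
     (auto simp: minors_def trek_ideal_def intro!: phi_minor_eq_0[OF assms])

section \<open>Paths and treks in a tree\<close>

lemma simple_path_self: "simple_path E i p i \<longleftrightarrow> p = [i]"
  by (cases p) (auto simp: simple_path_def split: if_splits)

lemma simple_path_split:
  assumes "simple_path E i (as @ v # bs) j"
  shows "simple_path E v (rev (as @ [v])) i" "simple_path E v (v # bs) j"
proof -
  have "simple_path E i (as @ [v]) v"
    using assms hd_append[of as "[v]"] hd_append[of as "v # bs"]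
    by (auto simp: simple_path_def successively_append_iff)
  then show "simple_path E v (rev (as @ [v])) i" by (rule simple_path_rev)
  show "simple_path E v (v # bs) j"
    using assms by (auto simp: simple_path_def successively_append_iff)
qed

lemma collider_at_append:
  "collider_at E (xs @ b # ys) m \<longleftrightarrow>
     m < length xs \<and> collider_at E (xs @ [b]) m \<or>
     m = length xs \<and> xs \<noteq> [] \<and> ys \<noteq> [] \<and> (last xs, b) \<in> E \<and> (hd ys, b) \<in> E \<or>
     length xs < m \<and> collider_at E (b # ys) (m - length xs)"
proof -
  consider "m < length xs" | "m = length xs" | k where "m = length xs + Suc k"
    by (metis less_imp_Suc_add linorder_neqE_nat add_Suc_right)
  then show ?thesis
  proof cases
    case 1
    then show ?thesis by (auto simp: collider_at_def nth_append less_Suc_eq)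
  next
    case 2
    then show ?thesis
      by (cases ys) (auto simp: collider_at_def nth_append last_conv_nth)
  next
    case 3
    then show ?thesis by (auto simp: collider_at_def nth_append)
  qed
qed

lemma no_collider_append:
  "(\<forall>m. \<not> collider_at E (xs @ b # ys) m) \<longleftrightarrow>
     (\<forall>m. \<not> collider_at E (xs @ [b]) m) \<and> (\<forall>m. \<not> collider_at E (b # ys) m) \<and>
     \<not> (xs \<noteq> [] \<and> ys \<noteq> [] \<and> (last xs, b) \<in> E \<and> (hd ys, b) \<in> E)"
    (is "?l \<longleftrightarrow> ?r")
proof
  assume l: ?l
  have "\<not> collider_at E (xs @ [b]) m" for m
    using l collider_at_append[of E xs b ys m]
    by (cases "m < length xs") (auto simp: collider_at_def)
  moreover have "\<not> collider_at E (b # ys) m" for m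
    using l collider_at_append[of E xs b ys "m + length xs"]
    by (cases "m = 0") (auto simp: collider_at_def)
  ultimately show ?r using l collider_at_append[of E xs b ys "length xs"] by auto
next
  assume ?r
  then show ?l unfolding collider_at_append[of E xs b ys] by blast
qed

lemma path_edges_append:
  assumes "distinct (as @ v # bs)"
  shows "(v, y) \<in> path_edges E (as @ v # bs) \<longleftrightarrow>
      (v, y) \<in> E \<and> (as \<noteq> [] \<and> last as = y \<or> bs \<noteq> [] \<and> hd bs = y)"
    and "(y, v) \<in> path_edges E (as @ v # bs) \<longleftrightarrow>
      (y, v) \<in> E \<and> (as \<noteq> [] \<and> last as = y \<or> bs \<noteq> [] \<and> hd bs = y)"
proof -
  let ?p = "as @ v # bs" and ?n = "length as"
  have nth: "m < length ?p \<Longrightarrow> ?p ! m = v \<longleftrightarrow> m = ?n" for m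
    using assms nth_eq_iff_index_eq[OF assms, of m ?n] by simp
  have "(\<exists>m. Suc m < length ?p \<and> (?p ! m = v \<and> ?p ! Suc m = y \<or> ?p ! m = y \<and> ?p ! Suc m = v)) \<longleftrightarrow>
      as \<noteq> [] \<and> last as = y \<or> bs \<noteq> [] \<and> hd bs = y" (is "?l \<longleftrightarrow> ?r")
  proof
    assume ?l
    then obtain m where m: "Suc m < length ?p"
      "?p ! m = v \<and> ?p ! Suc m = y \<or> ?p ! m = y \<and> ?p ! Suc m = v" by blast
    then have "m = ?n \<and> ?p ! Suc m = y \<or> Suc m = ?n \<and> ?p ! m = y"
      using nth[of m] nth[of "Suc m"] by auto
    then show ?r
    proof
      assume "m = ?n \<and> ?p ! Suc m = y"
      then show ?r using m(1) by (cases bs) (auto simp: nth_append)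
    next
      assume "Suc m = ?n \<and> ?p ! m = y"
      then have "as \<noteq> []" "m = length as - 1" "as ! m = y" by (auto simp: nth_append)
      then show ?r by (auto simp: last_conv_nth)
    qed
  next
    assume ?r
    then show ?l
    proof
      assume "as \<noteq> [] \<and> last as = y"
      then show ?l
        by (intro exI[of _ "?n - 1"]) (auto simp: nth_append last_conv_nth Suc_diff_Suc)
    next
      assume "bs \<noteq> [] \<and> hd bs = y"
      then show ?l by (intro exI[of _ ?n]) (cases bs, auto simp: nth_append)
    qed
  qed
  note eq = this
  show "(v, y) \<in> path_edges E ?p \<longleftrightarrow>
      (v, y) \<in> E \<and> (as \<noteq> [] \<and> last as = y \<or> bs \<noteq> [] \<and> hd bs = y)"
    and "(y, v) \<in> path_edges E ?p \<longleftrightarrow>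
      (y, v) \<in> E \<and> (as \<noteq> [] \<and> last as = y \<or> bs \<noteq> [] \<and> hd bs = y)"
    using eq by (auto simp: path_edges_def)
qed

locale ordered_tree =
  fixes E :: "('v::{finite,linorder} \<times> 'v) set"
  assumes ordered: "numerically_ordered E"
    and connected: "\<exists>p. simple_path E i p j"
    and acyclic: "\<nexists>p. undirected_cycle E p"
begin

lemma edge_less: "(u, v) \<in> E \<Longrightarrow> u < v"
  using ordered by (auto simp: numerically_ordered_def)

text \<open>Step from \<open>x\<close> back to its predecessor on the first path. This either
  shortens \<open>q\<close>, and the induction hypothesis applies, or extends it, and then
  \<open>p\<close> would pass through \<open>x\<close>.\<close>

lemma simple_path_unique:
  assumes "simple_path E i p x" "simple_path E i q x"
  shows "p = q"
  using assms
proof (induction p arbitrary: x q rule: rev_induct)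
  case Nil
  then show ?case by (simp add: simple_path_def)
next
  case (snoc y p)
  have "y = x" using snoc.prems by (simp add: simple_path_def)
  show ?case
  proof (cases "p = []")
    case True
    then have "i = x" using snoc.prems \<open>y = x\<close> by (simp add: simple_path_def)
    then show ?thesis using snoc.prems simple_path_self by metis
  next
    case False
    let ?u = "last p"
    have p: "simple_path E i p ?u" "x \<notin> set p" "adjacent E x ?u"
      using snoc.prems(1) simple_path_snoc[OF False, of E i y x] \<open>y = x\<close>
      by (auto simp: adjacent_def)
    from ordered acyclic snoc.prems(2) p(3) show ?thesis
    proof (cases rule: simple_path_step)
      case 1
      then have "p = q @ [?u]" using snoc.IH p(1) by blast
      moreover have "x \<in> set q" using snoc.prems(2) by (auto simp: simple_path_def)
      ultimately have "x \<in> set p" by (metis Un_iff set_append)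
      then show ?thesis using p(2) by blast
    next
      case (2 r)
      then have "p = r" using snoc.IH p(1) by blast
      then show ?thesis using 2 \<open>y = x\<close> by simp
    qed
  qed
qed

definition path :: "'v \<Rightarrow> 'v \<Rightarrow> 'v list" where
  "path i j = (THE p. simple_path E i p j)"

lemma path_eqI: "simple_path E i p j \<Longrightarrow> path i j = p"
  unfolding path_def using simple_path_unique by blast

lemma path: "simple_path E i (path i j) j"
  using connected path_eqI by metis

lemma path_simps [simp]:
  "path i j \<noteq> []" "hd (path i j) = i" "last (path i j) = j" "distinct (path i j)"
  "i \<in> set (path i j)" "j \<in> set (path i j)"
  using path[of i j] hd_in_set[of "path i j"] last_in_set[of "path i j"]
  by (auto simp: simple_path_def)

lemma path_self [simp]: "path i i = [i]"
  using path simple_path_self by metis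

lemma path_rev: "path j i = rev (path i j)"
  by (rule path_eqI) (rule simple_path_rev[OF path])

lemma path_decomp:
  assumes "v \<in> set (path i j)"
  obtains as bs where "path i j = as @ v # bs" "path v i = v # rev as" "path v j = v # bs"
proof -
  obtain as bs where p: "path i j = as @ v # bs" using assms by (meson split_list)
  have "simple_path E i (as @ v # bs) j" using path[of i j] p by simp
  from simple_path_split[OF this, THEN path_eqI] show ?thesis using that[OF p] by simp
qed

text \<open>The direction from \<open>v\<close> towards \<open>w\<close>: the first step of the path, with value \<open>v\<close> if \<open>w = v\<close>.\<close>

definition toward :: "'v \<Rightarrow> 'v \<Rightarrow> 'v" where
  "toward v w = hd (tl (path v w) @ [v])"

lemma toward_eq_iff [simp]: "toward v w = v \<longleftrightarrow> w = v"
proof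
  assume t: "toward v w = v"
  obtain bs where bs: "path v w = v # bs"
    by (rule path_decomp[of v v w]) auto
  have "v \<notin> set bs" using path_simps(4)[of v w] by (simp add: bs)
  then have "bs = []" using t bs by (cases bs) (auto simp: toward_def)
  then show "w = v" using path_simps(3)[of v w] bs by simp
qed (simp add: toward_def)

lemma toward_self [simp]: "toward v v = v"
  by simp

lemma toward_on_path:
  assumes "w \<in> set (path v i)" "w \<noteq> v"
  shows "toward v w = toward v i"
proof -
  obtain as bs where p: "path v i = as @ w # bs" "path w v = w # rev as"
    using assms by (elim path_decomp)
  then have "path v w = as @ [w]" using path_rev[of v w] by simp
  moreover have "as \<noteq> []" using path_simps(2)[of v i] p assms(2) by auto
  ultimately show ?thesis using p by (cases as) (auto simp: toward_def hd_append)
qed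

text \<open>A common vertex besides \<open>v\<close> of the two paths out of \<open>v\<close> forces
  a common first step. So paths that start differently meet only in \<open>v\<close> and glue there
  to the path from \<open>i\<close> to \<open>j\<close>.\<close>

lemma on_path_iff:
  "v \<in> set (path i j) \<longleftrightarrow> i = v \<or> j = v \<or> toward v i \<noteq> toward v j" (is "?l \<longleftrightarrow> ?r")
proof
  assume ?l
  then obtain as bs where p: "path i j = as @ v # bs" "path v i = v # rev as" "path v j = v # bs"
    by (rule path_decomp)
  show ?r
  proof (rule ccontr)
    assume "\<not> ?r"
    then have ne: "i \<noteq> v" "j \<noteq> v" "hd (rev as @ [v]) = hd (bs @ [v])"
      using p by (auto simp: toward_def)
    have "as \<noteq> []" "bs \<noteq> []" using ne p path_simps(2,3)[of i j] by auto
    then have "hd (rev as) = hd bs" using ne(3) by simp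
    then have "hd bs \<in> set as" using \<open>as \<noteq> []\<close> hd_in_set[of "rev as"] by simp
    moreover have "hd bs \<in> set bs" using \<open>bs \<noteq> []\<close> by simp
    ultimately show False using path_simps(4)[of i j] p(1) by auto
  qed
next
  assume r: ?r
  obtain as where as: "path v i = v # as" by (rule path_decomp[of v v i]) auto
  obtain bs where bs: "path v j = v # bs" by (rule path_decomp[of v v j]) auto
  have disj: "set as \<inter> set bs = {}"
  proof (rule ccontr)
    assume "\<not> ?thesis"
    then obtain w where w: "w \<in> set as" "w \<in> set bs" by auto
    have "v \<notin> set as" using path_simps(4)[of v i] as by simp
    then have "w \<noteq> v" using w by auto
    then have "toward v i = toward v j"
      using toward_on_path[of w v i] toward_on_path[of w v j] w as bs by simp
    moreover have "i \<noteq> v" "j \<noteq> v" using w as bs by auto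
    ultimately show False using r by simp
  qed
  have "simple_path E i (rev as @ v # bs) j"
  proof -
    have 1: "simple_path E i (rev as @ [v]) v" using simple_path_rev[OF path[of v i]] as by simp
    have 2: "simple_path E v (v # bs) j" using path[of v j] bs by simp
    show ?thesis
      unfolding simple_path_def
    proof (intro conjI)
      show "hd (rev as @ v # bs) = i" using 1 by (cases "rev as") (auto simp: simple_path_def)
      show "last (rev as @ v # bs) = j" using 2 by (auto simp: simple_path_def)
      show "distinct (rev as @ v # bs)" using 1 2 disj by (auto simp: simple_path_def)
      show "successively (adjacent E) (rev as @ v # bs)"
        using 1 2 by (auto simp: simple_path_def successively_append_iff)
    qed simp
  qed
  then show ?l using path_eqI by simp
qed

section \<open>Treks through a fixed vertex\<close>

definition is_trek :: "'v \<Rightarrow> 'v \<Rightarrow> bool" where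
  "is_trek i j \<longleftrightarrow> (\<forall>m. \<not> collider_at E (path i j) m)"

lemma treks_eq: "treks E i j = (if is_trek i j then {path i j} else {})"
proof -
  have "simple_path E i p j \<longleftrightarrow> p = path i j" for p using path path_eqI by metis
  then show ?thesis by (auto simp: treks_def is_trek_def)
qed

lemma is_trek_commute: "is_trek i j \<longleftrightarrow> is_trek j i"
  using collider_at_rev[of E "path i j"] collider_at_rev[of E "path j i"]
  by (metis is_trek_def path_rev)

definition trek_via :: "'v \<Rightarrow> 'v \<Rightarrow> 'v \<Rightarrow> bool" where
  "trek_via v i j \<longleftrightarrow> is_trek i j \<and> v \<in> set (path i j)"

lemma trek_via_commute: "trek_via v i j \<longleftrightarrow> trek_via v j i"
  using is_trek_commute path_rev[of i j] by (auto simp: trek_via_def)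

text \<open>Two directions at \<open>v\<close> are compatible if a trek may pass from one to the other through \<open>v\<close>.
  The direction \<open>v\<close> itself stands for ending at \<open>v\<close>, which is compatible with everything. On the
  other directions incompatibility is an equivalence relation: all parents of \<open>v\<close> form one class, and
  each child of \<open>v\<close> is a class of its own.\<close>

definition compatible :: "'v \<Rightarrow> 'v \<Rightarrow> 'v \<Rightarrow> bool" where
  "compatible v x y \<longleftrightarrow> x = v \<or> y = v \<or> x \<noteq> y \<and> \<not> ((x, v) \<in> E \<and> (y, v) \<in> E)"

lemma compatible_commute: "compatible v x y \<longleftrightarrow> compatible v y x"
  by (auto simp: compatible_def)

lemma incompatible_trans:
  "\<not> compatible v x y \<Longrightarrow> \<not> compatible v y z \<Longrightarrow> \<not> compatible v x z"
  by (auto simp: compatible_def)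

text \<open>Gluing the two halves can create a collider only at \<open>v\<close>. The conditions on
  the two ends thus separate, up to their directions at \<open>v\<close>, which is what permits
  exchanges.\<close>

lemma trek_via_iff:
  "trek_via v i j \<longleftrightarrow> is_trek v i \<and> is_trek v j \<and> compatible v (toward v i) (toward v j)"
proof (cases "v \<in> set (path i j)")
  case True
  then obtain as bs where p: "path i j = as @ v # bs" "path v i = v # rev as" "path v j = v # bs"
    by (rule path_decomp)
  have iv: "path i v = as @ [v]" using path_rev[of i v] p(2) by simp
  have as: "as = [] \<longleftrightarrow> i = v" using path_simps(2)[of i v] path_self[of v] iv by (cases as) auto
  have bs: "bs = [] \<longleftrightarrow> j = v" using path_simps(3)[of v j] path_self[of v] p(3) by (cases bs) auto
  have t: "as \<noteq> [] \<Longrightarrow> toward v i = last as" "bs \<noteq> [] \<Longrightarrow> toward v j = hd bs"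
    using p by (auto simp: toward_def hd_rev)
  have "is_trek i j \<longleftrightarrow> is_trek i v \<and> is_trek v j \<and>
      \<not> (as \<noteq> [] \<and> bs \<noteq> [] \<and> (last as, v) \<in> E \<and> (hd bs, v) \<in> E)"
    unfolding is_trek_def p iv by (rule no_collider_append)
  then show ?thesis
    using True as bs t is_trek_commute[of i v] by (auto simp: trek_via_def compatible_def on_path_iff)
next
  case False
  then show ?thesis by (auto simp: trek_via_def on_path_iff compatible_def)
qed

lemma trek_via_compatible:
  "trek_via v i j \<Longrightarrow> compatible v (toward v i) (toward v j)"
  by (simp add: trek_via_iff)

lemma trek_via_exchange:
  assumes "trek_via v i j" "trek_via v k l" "compatible v (toward v i) (toward v l)"
  shows "trek_via v i l"
  using assms by (simp add: trek_via_iff)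

lemma path_edges_toward:
  assumes "v \<in> set (path i j)" "y \<noteq> v"
  shows "(v, y) \<in> path_edges E (path i j) \<or> (y, v) \<in> path_edges E (path i j) \<longleftrightarrow>
    toward v i = y \<or> toward v j = y"
proof -
  obtain as bs where p: "path i j = as @ v # bs" "path v i = v # rev as" "path v j = v # bs"
    using assms(1) by (rule path_decomp)
  have t: "toward v i = y \<longleftrightarrow> as \<noteq> [] \<and> last as = y" "toward v j = y \<longleftrightarrow> bs \<noteq> [] \<and> hd bs = y"
    using p assms(2) by (auto simp: toward_def hd_append hd_rev)
  have "adjacent E v y" if "as \<noteq> [] \<and> last as = y \<or> bs \<noteq> [] \<and> hd bs = y"
    using that path[of i j] unfolding simple_path_def p
    by (cases bs) (auto simp: successively_append_iff adjacent_def)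
  then show ?thesis
    using path_edges_append[of as v bs y E] path_simps(4)[of i j] unfolding p t adjacent_def
    by blast
qed

lemma toward_nth:
  assumes "Suc m < length (path i j)"
  shows "toward (path i j ! m) j = path i j ! Suc m"
proof -
  let ?v = "path i j ! m"
  have "path i j = take m (path i j) @ ?v # drop (Suc m) (path i j)"
    using assms by (simp add: id_take_nth_drop)
  then have "simple_path E ?v (?v # drop (Suc m) (path i j)) j"
    using path[of i j] simple_path_split(2) by metis
  then have "path ?v j = ?v # drop (Suc m) (path i j)" by (rule path_eqI)
  then show ?thesis using assms by (simp add: toward_def hd_append hd_drop_conv_nth)
qed

text \<open>From a vertex that no trek edge enters, the absence of colliders makes all edges point
  away on both sides. As edges increase, that vertex is the minimum of the trek; conversely no trek
  edge enters the minimum.\<close>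

lemma trek_top:
  assumes "is_trek i j"
  shows "top_vertex E (path i j) \<in> set (path i j)"
    and "v \<in> set (path i j) \<Longrightarrow>
      v = top_vertex E (path i j) \<longleftrightarrow> (\<forall>u. (u, v) \<notin> path_edges E (path i j))"
proof -
  let ?p = "path i j"
  have least: "v \<le> w" if v: "v \<in> set ?p" "\<forall>u. (u, v) \<notin> path_edges E ?p" and w: "w \<in> set ?p" for v w
  proof -
    obtain m where m: "m < length ?p" "?p ! m = v" using v by (auto simp: in_set_conv_nth)
    obtain n where n: "n < length ?p" "?p ! n = w" using w by (auto simp: in_set_conv_nth)
    have adj: "adjacent E (?p ! k) (?p ! Suc k)" if "Suc k < length ?p" for k
      using path[of i j] that by (auto simp: simple_path_def successively_nth)
    have col: "\<not> ((?p ! k, ?p ! Suc k) \<in> E \<and> (?p ! Suc (Suc k), ?p ! Suc k) \<in> E)"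
      if "Suc (Suc k) < length ?p" for k
      using assms that by (auto simp: is_trek_def collider_at_def dest: spec[of _ "Suc k"])
    have right: "(?p ! k, ?p ! Suc k) \<in> E" if "m \<le> k" "Suc k < length ?p" for k
      using that
    proof (induction k rule: dec_induct)
      case base
      have "(?p ! Suc m, v) \<notin> path_edges E ?p" using v by blast
      then have "(?p ! Suc m, v) \<notin> E" using base m unfolding path_edges_def by auto
      then show ?case using adj[OF base] m by (auto simp: adjacent_def)
    next
      case (step k)
      then show ?case using adj[of "Suc k"] col[of k] by (auto simp: adjacent_def)
    qed
    have left: "(?p ! Suc k, ?p ! k) \<in> E" if "k < m" for k
      using that
    proof (induction k rule: measure_induct_rule[where f = "\<lambda>k. m - k"])
      case (less k)
      show ?case
      proof (cases "Suc k = m")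
        case True
        have "(?p ! k, v) \<notin> path_edges E ?p" using v by blast
        then have "(?p ! k, v) \<notin> E" using True m unfolding path_edges_def by blast
        then show ?thesis using adj[of k] True m by (auto simp: adjacent_def)
      next
        case False
        then have "(?p ! Suc (Suc k), ?p ! Suc k) \<in> E" using less by auto
        then show ?thesis using adj[of k] col[of k] less.prems False m by (auto simp: adjacent_def)
      qed
    qed
    show ?thesis
    proof (cases "m \<le> n")
      case True
      then have "?p ! m \<le> ?p ! n" using n(1)
      proof (induction n rule: dec_induct)
        case (step k)
        then show ?case using edge_less[OF right[of k]] by auto
      qed simp
      then show ?thesis using m n by simp
    next
      case False
      then have "n \<le> m" by simp
      then have "?p ! m \<le> ?p ! n"
      proof (induction rule: inc_induct)
        case (step k)
        then show ?case using edge_less[OF left[of k]] by auto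
      qed simp
      then show ?thesis using m n by simp
    qed
  qed
  have "Min (set ?p) \<in> set ?p" by simp
  moreover have "(u, Min (set ?p)) \<notin> path_edges E ?p" for u
  proof
    assume u: "(u, Min (set ?p)) \<in> path_edges E ?p"
    then have "u < Min (set ?p)" by (intro edge_less) (auto simp: path_edges_def)
    moreover have "u \<in> set ?p" using u path_edges_in_set by fast
    ultimately show False by (simp add: leD)
  qed
  ultimately have top: "top_vertex E ?p = Min (set ?p)"
    unfolding top_vertex_def using least by (intro the_equality) (auto intro: antisym)
  then show "top_vertex E ?p \<in> set ?p" by simp
  assume v: "v \<in> set ?p"
  have "(\<forall>u. (u, v) \<notin> path_edges E ?p) \<Longrightarrow> v = Min (set ?p)"
    using least[OF v] by (intro Min_eqI[symmetric]) (use v in auto)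
  then show "v = top_vertex E ?p \<longleftrightarrow> (\<forall>u. (u, v) \<notin> path_edges E ?p)"
    using top \<open>\<And>u. (u, Min (set ?p)) \<notin> path_edges E ?p\<close> by auto
qed

lemma trek_incoming_unique:
  assumes "is_trek i j" "(u, v) \<in> path_edges E (path i j)" "(w, v) \<in> path_edges E (path i j)"
  shows "u = w"
proof (rule ccontr)
  assume "u \<noteq> w"
  have v: "v \<in> set (path i j)" "(u, v) \<in> E" "(w, v) \<in> E"
    using assms path_edges_in_set by (fast, auto simp: path_edges_def)
  have ne: "u \<noteq> v" "w \<noteq> v" using v edge_less by fastforce+
  have "toward v i = u \<or> toward v j = u" "toward v i = w \<or> toward v j = w"
    using path_edges_toward[OF v(1)] ne assms by blast+
  moreover have "compatible v (toward v i) (toward v j)"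
    using assms(1) v(1) by (intro trek_via_compatible) (simp add: trek_via_def)
  ultimately show False using \<open>u \<noteq> w\<close> ne v by (auto simp: compatible_def)
qed

end

section \<open>Connecting the fibres of the trek map by tetrads\<close>

lemma prod_single_one:
  "(\<Prod>x\<in>A. Poly_Mapping.single (f x) 1) = Poly_Mapping.single (sum f A) (1 :: 'b::comm_semiring_1)"
  by (induction A rule: infinite_finite_induct) (simp_all add: mult_single)

lemma \<sigma>_commute: "\<sigma> i j = \<sigma> j i"
  unfolding \<sigma>_def by (rule arg_cong[where f = Var]) simp

lemma ideal_gen_incl: "x \<in> S \<Longrightarrow> x \<in> ideal_gen S"
  unfolding ideal_gen_def by (rule module.span_base[OF module_mult])

lemma ideal_gen_0 [simp]: "0 \<in> ideal_gen S"
  unfolding ideal_gen_def by (rule module.span_zero[OF module_mult])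

lemma ideal_gen_add: "x \<in> ideal_gen S \<Longrightarrow> y \<in> ideal_gen S \<Longrightarrow> x + y \<in> ideal_gen S"
  unfolding ideal_gen_def by (rule module.span_add[OF module_mult])

lemma ideal_gen_mult: "x \<in> ideal_gen S \<Longrightarrow> c * x \<in> ideal_gen S"
  unfolding ideal_gen_def by (rule module.span_scale[OF module_mult])

lemma ideal_gen_minus: "x \<in> ideal_gen S \<Longrightarrow> - x \<in> ideal_gen S"
  unfolding ideal_gen_def by (rule module.span_neg[OF module_mult])

lemma ideal_gen_sum: "(\<And>x. x \<in> A \<Longrightarrow> f x \<in> ideal_gen S) \<Longrightarrow> sum f A \<in> ideal_gen S"
  unfolding ideal_gen_def by (rule module.span_sum[OF module_mult])

lemma ideal_gen_minimal: "S \<subseteq> ideal_gen T \<Longrightarrow> ideal_gen S \<subseteq> ideal_gen T"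
  unfolding ideal_gen_def
  by (rule module.span_minimal[OF module_mult _ module.subspace_span[OF module_mult]])

lemma ideal_gen_diff_trans:
  "x - y \<in> ideal_gen S \<Longrightarrow> y - z \<in> ideal_gen S \<Longrightarrow> x - z \<in> ideal_gen S"
  using ideal_gen_add[of "x - y" S "y - z"] by simp

lemma minor_single: "minor {i} {j} = \<sigma> i j"
  by (simp add: minor_def det_single)

lemma minor_pair:
  assumes "i < k" "j < l"
  shows "minor {i, k} {j, l} = tetrad i j k l"
proof -
  have s: "sorted_list_of_set {i, k} = [i, k]" "sorted_list_of_set {j, l} = [j, l]"
    using assms by auto
  have c: "card {i, k} = 2" "card {j, l} = 2" using assms by auto
  let ?A = "mat 2 2 (\<lambda>(r, s). \<sigma> ([i, k] ! r) ([j, l] ! s))"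
  have "det ?A = (\<Sum>r<2. ?A $$ (r, 0) * cofactor ?A r 0)"
    by (rule laplace_expansion_column) simp_all
  also have "\<dots> = \<sigma> i j * \<sigma> k l - \<sigma> i l * \<sigma> k j"
    by (simp add: numeral_2_eq_2 cofactor_def mat_delete_def det_single mult.commute)
  finally show ?thesis by (simp add: minor_def s c tetrad_def \<sigma>_commute[of k j])
qed

text \<open>Minors list their indices in increasing order, so sorting the pairs may cost a
  sign.\<close>

lemma minor_pair_cases:
  assumes "i \<noteq> k" "j \<noteq> l"
  shows "minor {i, k} {j, l} = tetrad i j k l \<or> minor {i, k} {j, l} = - tetrad i j k l"
proof -
  have t: "tetrad k j i l = - tetrad i j k l" "tetrad i l k j = - tetrad i j k l"
    "tetrad k l i j = tetrad i j k l"
    by (simp_all add: tetrad_def \<sigma>_commute algebra_simps)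
  have "i < k \<or> k < i" "j < l \<or> l < j" using assms by auto
  then show ?thesis
    using minor_pair[of i k j l] minor_pair[of k i j l] minor_pair[of i k l j] minor_pair[of k i l j]
    by (auto simp: t insert_commute)
qed

context ordered_tree
begin

section \<open>The tetrad ideal inside the conditional independence ideal\<close>

definition trek_gens :: "'v uprod cpoly set" where
  "trek_gens = {\<sigma> i j | i j. \<not> is_trek i j} \<union> {tetrad i j k l | i j k l.
     \<exists>v. trek_via v i j \<and> trek_via v k l \<and> trek_via v i l \<and> trek_via v k j}"

lemma ci_ideal_incl:
  assumes "A \<inter> B = {}" "A \<inter> C = {}" "B \<inter> C = {}" "d_separates E C A B"
    and "R \<subseteq> A \<union> C" "S \<subseteq> B \<union> C" "card R = card C + 1" "card S = card C + 1"
  shows "minor R S \<in> ci_ideal E"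
  unfolding ci_ideal_def minors_def using assms by (intro ideal_gen_incl) blast

lemma trek_gens_subset_ci_ideal: "trek_gens \<subseteq> ci_ideal E"
proof
  fix f assume "f \<in> trek_gens"
  then consider (linear) i j where "f = \<sigma> i j" "\<not> is_trek i j"
    | (tetrad) i j k l v where "f = tetrad i j k l"
        "trek_via v i j" "trek_via v k l" "trek_via v i l" "trek_via v k j"
    unfolding trek_gens_def by blast
  then show "f \<in> ci_ideal E"
  proof cases
    case linear
    have "i \<noteq> j" using linear(2) by (auto simp: is_trek_def collider_at_def)
    have "d_separates E {} {i} {j}"
      unfolding d_separates_def
    proof (intro ballI allI impI)
      fix a b p assume "a \<in> {i}" "b \<in> {j}" "simple_path E a p b"
      then have "path i j = p" using path_eqI by simp
      then obtain m where "collider_at E p m" using linear(2) by (auto simp: is_trek_def)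
      moreover from this have "m < length p" by (simp add: collider_at_def)
      ultimately show "\<exists>m<length p. \<not> collider_at E p m \<and> p ! m \<in> {} \<or>
          collider_at E p m \<and> p ! m \<notin> {} \<and> (\<forall>d. (p ! m, d) \<in> E\<^sup>+ \<longrightarrow> d \<notin> {})" by blast
    qed
    then have "minor {i} {j} \<in> ci_ideal E"
      using \<open>i \<noteq> j\<close> by (intro ci_ideal_incl[of "{i}" "{j}" "{}"]) auto
    then show ?thesis using linear(1) by (simp add: minor_single)
  next
    case tetrad
    show ?thesis
    proof (cases "i = k \<or> j = l")
      case True
      then have "f = 0" using tetrad(1) by (auto simp: tetrad_def \<sigma>_commute mult.commute)
      then show ?thesis by (simp add: ci_ideal_def)
    next
      case False
      \<comment> \<open>Removing \<open>v\<close> makes the sets disjoint from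
        \<open>C = {v}\<close>; rows and columns regain it through \<open>A \<union> C\<close> and
        \<open>B \<union> C\<close>.\<close>
      let ?A = "{i, k} - {v}" and ?B = "{j, l} - {v}"
      have via: "trek_via v a b" if "a \<in> {i, k}" "b \<in> {j, l}" for a b
        using that tetrad by auto
      have "?A \<inter> ?B = {}"
      \<comment> \<open>A common vertex \<open>a\<close> other than \<open>v\<close> would have its
        trivial path \<open>[a]\<close> pass through \<open>v\<close>.\<close>
      proof (rule ccontr)
        assume "?A \<inter> ?B \<noteq> {}"
        then obtain a where "a \<in> {i, k}" "a \<in> {j, l}" "a \<noteq> v" by auto
        then show False using via[of a a] by (simp add: trek_via_def)
      qed
      moreover have "d_separates E {v} ?A ?B"
        unfolding d_separates_def
      proof (intro ballI allI impI)
        fix a b p assume "a \<in> ?A" "b \<in> ?B" "simple_path E a p b"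
        then have "path a b = p" "trek_via v a b" using path_eqI via by auto
        then have "v \<in> set p" "\<forall>m. \<not> collider_at E p m" by (auto simp: trek_via_def is_trek_def)
        then show "\<exists>m<length p. \<not> collider_at E p m \<and> p ! m \<in> {v} \<or>
            collider_at E p m \<and> p ! m \<notin> {v} \<and> (\<forall>d. (p ! m, d) \<in> E\<^sup>+ \<longrightarrow> d \<notin> {v})"
          by (auto simp: in_set_conv_nth)
      qed
      ultimately have "minor {i, k} {j, l} \<in> ci_ideal E"
        using False by (intro ci_ideal_incl[of ?A ?B "{v}"]) auto
      moreover from this have "- minor {i, k} {j, l} \<in> ci_ideal E"
        unfolding ci_ideal_def by (rule ideal_gen_minus)
      ultimately show ?thesis
        using minor_pair_cases[of i k j l] False tetrad(1) by auto
    qed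
  qed
qed

abbreviation tetrad_ideal :: "'v uprod cpoly set" where "tetrad_ideal \<equiv> ideal_gen trek_gens"

lemma tetrad_ideal_subset_ci_ideal: "tetrad_ideal \<subseteq> ci_ideal E"
  unfolding ci_ideal_def
  by (rule ideal_gen_minimal) (use trek_gens_subset_ci_ideal in \<open>simp add: ci_ideal_def\<close>)

lemma phi_eq_mod_tetrad_ideal:
  assumes "f - g \<in> tetrad_ideal"
  shows "phi E f = phi E g"
proof -
  have "f - g \<in> trek_ideal E"
    using assms tetrad_ideal_subset_ci_ideal ci_ideal_subset_trek_ideal[OF ordered acyclic] by blast
  then show ?thesis by (simp add: trek_ideal_def phi.hom_minus)
qed

section \<open>Images of monomials and the counts they determine\<close>

definition trek_exponent :: "'v \<times> 'v \<Rightarrow> 'v param \<Rightarrow>\<^sub>0 nat" where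
  "trek_exponent = (\<lambda>(i, j). Poly_Mapping.single (Avar (top_vertex E (path i j))) 1 +
     (\<Sum>(k, l)\<in>path_edges E (path i j). Poly_Mapping.single (Lvar k l) 1))"

lemma lookup_trek_exponent:
  "Poly_Mapping.lookup (trek_exponent (i, j)) (Avar v) = of_bool (top_vertex E (path i j) = v)"
  "Poly_Mapping.lookup (trek_exponent (i, j)) (Lvar k l) = of_bool ((k, l) \<in> path_edges E (path i j))"
proof -
  show "Poly_Mapping.lookup (trek_exponent (i, j)) (Avar v) = of_bool (top_vertex E (path i j) = v)"
    by (simp add: trek_exponent_def lookup_add lookup_sum lookup_single when_def split_def)
  have "(\<Sum>e\<in>path_edges E (path i j).
      Poly_Mapping.lookup (case e of (a, b) \<Rightarrow> Poly_Mapping.single (Lvar a b) (1::nat)) (Lvar k l)) =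
      (\<Sum>e\<in>path_edges E (path i j). if e = (k, l) then 1 else 0)"
    by (intro sum.cong refl) (auto simp: lookup_single when_def split: if_splits)
  then show "Poly_Mapping.lookup (trek_exponent (i, j)) (Lvar k l) =
      of_bool ((k, l) \<in> path_edges E (path i j))"
    by (simp add: trek_exponent_def lookup_add lookup_sum lookup_single when_def)
qed

lemma phi_trek:
  assumes "is_trek i j"
  shows "phi E (\<sigma> i j) = Poly_Mapping.single (trek_exponent (i, j)) 1"
proof -
  have "(\<Prod>(k, l)\<in>path_edges E (path i j). Var (Lvar k l)) =
      Poly_Mapping.single (\<Sum>(k, l)\<in>path_edges E (path i j). Poly_Mapping.single (Lvar k l) 1) (1::complex)"
    using prod_single_one[of "\<lambda>(k, l). Poly_Mapping.single (Lvar k l) 1" "path_edges E (path i j)"]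
    by (simp add: Var_def split_def del: One_nat_def)
  then show ?thesis
    using assms
    by (simp add: phi_\<sigma> trek_poly_def treks_eq trek_exponent_def Var_def[of "Avar _"] mult_single)
qed

text \<open>A multiset of pairs is a monomial in the \<open>\<sigma>\<^sub>i\<^sub>j\<close>; \<open>all_treks\<close> selects those on which \<open>phi\<close> does
  not vanish.\<close>

definition all_treks :: "('v \<times> 'v) multiset \<Rightarrow> bool" where
  "all_treks M \<longleftrightarrow> (\<forall>(i, j)\<in>#M. is_trek i j)"

definition \<sigma>_monom :: "('v \<times> 'v) multiset \<Rightarrow> 'v uprod cpoly" where
  "\<sigma>_monom M = (\<Prod>(i, j)\<in>#M. \<sigma> i j)"

definition exponent :: "('v \<times> 'v) multiset \<Rightarrow> 'v param \<Rightarrow>\<^sub>0 nat" where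
  "exponent M = (\<Sum>p\<in>#M. trek_exponent p)"

lemma all_treks_simps [simp]:
  "all_treks {#}" "all_treks (add_mset (i, j) M) \<longleftrightarrow> is_trek i j \<and> all_treks M"
  by (auto simp: all_treks_def)

lemma \<sigma>_monom_simps [simp]:
  "\<sigma>_monom {#} = 1" "\<sigma>_monom (add_mset (i, j) M) = \<sigma> i j * \<sigma>_monom M"
  by (auto simp: \<sigma>_monom_def)

lemma exponent_simps [simp]:
  "exponent {#} = 0" "exponent (add_mset p M) = trek_exponent p + exponent M"
  by (auto simp: exponent_def)

lemma phi_\<sigma>_monom:
  "all_treks M \<Longrightarrow> phi E (\<sigma>_monom M) = Poly_Mapping.single (exponent M) 1"
proof (induction M)
  case (add p M)
  then show ?case by (cases p) (simp add: phi.hom_mult phi_trek mult_single)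
qed (simp add: phi.hom_one)

lemma exponent_eq_iff:
  assumes "all_treks M" "all_treks N"
  shows "exponent M = exponent N \<longleftrightarrow> phi E (\<sigma>_monom M) = phi E (\<sigma>_monom N)"
proof
  assume "phi E (\<sigma>_monom M) = phi E (\<sigma>_monom N)"
  then have "Poly_Mapping.keys (Poly_Mapping.single (exponent M) (1::complex)) =
      Poly_Mapping.keys (Poly_Mapping.single (exponent N) (1::complex))"
    using assms by (simp add: phi_\<sigma>_monom)
  then show "exponent M = exponent N" by simp
qed (use assms in \<open>simp add: phi_\<sigma>_monom\<close>)

lemma exponent_cong:
  assumes "all_treks M" "all_treks N" "\<sigma>_monom M - \<sigma>_monom N \<in> tetrad_ideal"
  shows "exponent M = exponent N"
  using assms exponent_eq_iff phi_eq_mod_tetrad_ideal by blast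

text \<open>Summed over a monomial, these numbers can be read off its image under \<open>phi\<close>: for \<open>y \<noteq> v\<close> from the
  exponents of the edges, and for \<open>y = v\<close> because a trek through \<open>v\<close> has two directions there.\<close>

definition dir_count :: "'v \<Rightarrow> 'v \<Rightarrow> 'v \<times> 'v \<Rightarrow> nat" where
  "dir_count v y = (\<lambda>(i, j). if v \<in> set (path i j)
     then of_bool (toward v i = y) + of_bool (toward v j = y) else 0)"

definition visits :: "'v \<Rightarrow> 'v \<times> 'v \<Rightarrow> nat" where
  "visits v = (\<lambda>(i, j). of_bool (v \<in> set (path i j)))"

lemma sum_dir_count: "(\<Sum>y\<in>UNIV. dir_count v y p) = 2 * visits v p"
  by (cases p) (simp add: dir_count_def visits_def sum.distrib of_bool_def)

lemma dir_count_exponent: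
  assumes "is_trek i j" "y \<noteq> v"
  shows "dir_count v y (i, j) =
    Poly_Mapping.lookup (trek_exponent (i, j)) (Lvar v y) + Poly_Mapping.lookup (trek_exponent (i, j)) (Lvar y v)"
proof (cases "v \<in> set (path i j)")
  case True
  have "\<not> (toward v i = y \<and> toward v j = y)"
  proof
    assume "toward v i = y \<and> toward v j = y"
    then have "toward v i = toward v j" "toward v i \<noteq> v" "toward v j \<noteq> v" using assms(2) by auto
    then show False using True unfolding on_path_iff toward_eq_iff by blast
  qed
  moreover have "\<not> ((v, y) \<in> path_edges E (path i j) \<and> (y, v) \<in> path_edges E (path i j))"
    using numerically_ordered_asym[OF ordered] by (auto simp: path_edges_def)
  ultimately show ?thesis
    using True path_edges_toward[OF True assms(2)]
    by (auto simp: dir_count_def lookup_trek_exponent)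
next
  case False
  then show ?thesis
    using path_edges_in_set[of _ _ E "path i j"] by (auto simp: dir_count_def lookup_trek_exponent)
qed

text \<open>A vertex on a trek either is its top or has exactly one incoming trek edge, never
  both.\<close>

lemma visits_exponent:
  assumes "is_trek i j"
  shows "visits v (i, j) = Poly_Mapping.lookup (trek_exponent (i, j)) (Avar v) +
    (\<Sum>u\<in>UNIV. Poly_Mapping.lookup (trek_exponent (i, j)) (Lvar u v))"
proof (cases "v \<in> set (path i j)")
  case False
  then show ?thesis
    using path_edges_in_set[of _ _ E "path i j"] trek_top(1)[OF assms]
    by (auto simp: visits_def lookup_trek_exponent)
next
  case True
  show ?thesis
  proof (cases "v = top_vertex E (path i j)")
    case top: True
    then have "(u, v) \<notin> path_edges E (path i j)" for u
      using trek_top(2)[OF assms True] by blast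
    then show ?thesis using True top by (simp add: visits_def lookup_trek_exponent)
  next
    case False
    then obtain u where u: "(u, v) \<in> path_edges E (path i j)"
      using trek_top(2)[OF assms True] by blast
    then have "(w, v) \<in> path_edges E (path i j) \<longleftrightarrow> w = u" for w
      using trek_incoming_unique[OF assms u, of w] by blast
    then show ?thesis using True False by (simp add: visits_def lookup_trek_exponent of_bool_def)
  qed
qed

lemma sum_visits_exponent:
  "all_treks M \<Longrightarrow> (\<Sum>p\<in>#M. visits v p) =
    Poly_Mapping.lookup (exponent M) (Avar v) + (\<Sum>u\<in>UNIV. Poly_Mapping.lookup (exponent M) (Lvar u v))"
proof (induction M)
  case (add p M)
  then show ?case
    by (cases p) (simp add: visits_exponent lookup_add sum.distrib del: sum_of_bool_eq)
qed simp

lemma sum_dir_count_exponent: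
  "all_treks M \<Longrightarrow> y \<noteq> v \<Longrightarrow> (\<Sum>p\<in>#M. dir_count v y p) =
    Poly_Mapping.lookup (exponent M) (Lvar v y) + Poly_Mapping.lookup (exponent M) (Lvar y v)"
proof (induction M)
  case (add p M)
  then show ?case by (cases p) (simp add: dir_count_exponent lookup_add)
qed simp

lemma sum_visits_cong:
  assumes "all_treks M" "all_treks N" "exponent M = exponent N"
  shows "(\<Sum>p\<in>#M. visits v p) = (\<Sum>p\<in>#N. visits v p)"
  using assms by (simp add: sum_visits_exponent)

lemma sum_dir_count_cong:
  assumes "all_treks M" "all_treks N" "exponent M = exponent N"
  shows "(\<Sum>p\<in>#M. dir_count v y p) = (\<Sum>p\<in>#N. dir_count v y p)"
proof (cases "y = v")
  case False
  then show ?thesis using assms by (simp add: sum_dir_count_exponent)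
next
  case True
  have split: "(\<Sum>p\<in>#M. dir_count v v p) + (\<Sum>y\<in>UNIV - {v}. \<Sum>p\<in>#M. dir_count v y p) =
      2 * (\<Sum>p\<in>#M. visits v p)" for M
  proof -
    have "2 * (\<Sum>p\<in>#M. visits v p) = (\<Sum>y\<in>UNIV. \<Sum>p\<in>#M. dir_count v y p)"
      by (induction M) (simp_all add: sum.distrib sum_dir_count)
    then show ?thesis by (simp add: sum.remove[of UNIV v])
  qed
  have "(\<Sum>y\<in>UNIV - {v}. \<Sum>p\<in>#M. dir_count v y p) = (\<Sum>y\<in>UNIV - {v}. \<Sum>p\<in>#N. dir_count v y p)"
    using assms by (intro sum.cong refl) (simp add: sum_dir_count_exponent)
  then show ?thesis
    using split[of M] split[of N] sum_visits_cong[OF assms, of v] True by simp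
qed

section \<open>Growing a trek inside a monomial\<close>

lemma exchange:
  assumes "trek_via v i b" "trek_via v k l"
    and "compatible v (toward v i) (toward v l)" "compatible v (toward v k) (toward v b)"
    and "all_treks R"
  shows "\<sigma>_monom (add_mset (i, b) (add_mset (k, l) R)) -
      \<sigma>_monom (add_mset (i, l) (add_mset (k, b) R)) \<in> tetrad_ideal" (is "?d \<in> tetrad_ideal")
    and "trek_via v i l" "trek_via v k b"
    and "all_treks (add_mset (i, l) (add_mset (k, b) R))"
proof -
  show il: "trek_via v i l" using trek_via_exchange assms by blast
  show kb: "trek_via v k b" using trek_via_exchange assms by blast
  have "tetrad i b k l \<in> tetrad_ideal"
    using assms il kb by (intro ideal_gen_incl) (auto simp: trek_gens_def)
  then have "\<sigma>_monom R * tetrad i b k l \<in> tetrad_ideal" by (rule ideal_gen_mult)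
  also have "\<sigma>_monom R * tetrad i b k l = ?d"
    by (simp add: tetrad_def \<sigma>_commute[of b k] algebra_simps)
  finally show "?d \<in> tetrad_ideal" .
  show "all_treks (add_mset (i, l) (add_mset (k, b) R))"
    using il kb assms(5) by (simp add: trek_via_def)
qed

text \<open>Pairs in \<open>M\<close> are ordered although \<open>\<sigma>\<close> is symmetric; the
  trek found is turned so that its second end lies in direction \<open>y\<close>.\<close>

lemma dir_count_posE:
  assumes "0 < (\<Sum>p\<in>#M. dir_count v y p)" "all_treks M"
  obtains k l R where "M = add_mset (k, l) R \<or> M = add_mset (l, k) R"
    "all_treks (add_mset (k, l) R)" "\<sigma>_monom M = \<sigma>_monom (add_mset (k, l) R)"
    "trek_via v k l" "toward v l = y"
proof -
  have "\<exists>p\<in>#M. dir_count v y p \<noteq> 0"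
    using assms(1) by (auto simp: sum_mset_0_iff simp flip: neq0_conv)
  then obtain i j where p: "(i, j) \<in># M" "dir_count v y (i, j) \<noteq> 0" by auto
  then obtain R where R: "M = add_mset (i, j) R" by (meson mset_add)
  have "trek_via v i j"
    using p assms(2) R by (auto simp: dir_count_def trek_via_def split: if_splits)
  moreover have "toward v i = y \<or> toward v j = y"
    using p by (auto simp: dir_count_def split: if_splits)
  ultimately show ?thesis
    using that[of i j R] that[of j i R] R assms(2) trek_via_commute[of v i j] is_trek_commute[of i j]
      \<sigma>_commute[of i j] by auto
qed

text \<open>\<open>M\<close> contains a trek that leaves \<open>v\<close> from \<open>i\<close> in another direction \<open>y'\<close> than the trek from \<open>i\<close> to
  \<open>j\<close> does. Some other trek of \<open>M\<close> uses the desired direction, and the two are exchanged at \<open>v\<close>. If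
  the two left-over directions are incompatible then, by counting, a third trek through \<open>v\<close> avoids
  the class of \<open>y'\<close>, and a detour over that trek works.\<close>

lemma redirect:
  assumes good: "all_treks (add_mset (i, j) N)" "all_treks (add_mset (i, b) M)"
    and eq: "exponent (add_mset (i, j) N) = exponent (add_mset (i, b) M)"
    and via: "trek_via v i j" "trek_via v i b"
  obtains c R where "all_treks (add_mset (i, c) R)"
    "\<sigma>_monom (add_mset (i, b) M) - \<sigma>_monom (add_mset (i, c) R) \<in> tetrad_ideal"
    "trek_via v i c" "toward v c = toward v j"
proof (cases "toward v b = toward v j")
  case True
  then show ?thesis using that[of b M] good via by simp
next
  case False
  let ?x = "toward v i" and ?y = "toward v j" and ?y' = "toward v b"
  have on: "v \<in> set (path i j)" "v \<in> set (path i b)" using via by (simp_all add: trek_via_def)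
  have "(\<Sum>p\<in>#add_mset (i, j) N. dir_count v ?y p) = (\<Sum>p\<in>#add_mset (i, b) M. dir_count v ?y p)"
    by (rule sum_dir_count_cong[OF good eq])
  \<comment> \<open>The trek from \<open>i\<close> to \<open>j\<close> uses \<open>?y\<close> once
    more than the one from \<open>i\<close> to \<open>b\<close>, so \<open>M\<close> must
    compensate.\<close>
  then have "0 < (\<Sum>p\<in>#M. dir_count v ?y p)"
    using False on by (simp add: dir_count_def)
  then obtain k l R where kl: "M = add_mset (k, l) R \<or> M = add_mset (l, k) R"
    "all_treks (add_mset (k, l) R)" "\<sigma>_monom M = \<sigma>_monom (add_mset (k, l) R)"
    "trek_via v k l" "toward v l = ?y"
    by (rule dir_count_posE) (use good in simp)
  let ?x' = "toward v k"
  have R: "all_treks R" using kl(2) by simp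
  have xy: "compatible v ?x ?y" "compatible v ?x ?y'" "compatible v ?x' ?y"
    using trek_via_compatible via kl(4,5) by metis+
  show ?thesis
  proof (cases "compatible v ?x' ?y'")
    case True
    have "compatible v ?x (toward v l)" using xy kl(5) by simp
    from exchange[OF via(2) kl(4) this True R] show ?thesis
      using that[of l "add_mset (k, b) R"] kl(3,5) by simp
  next
    case incomp: False
    \<comment> \<open>\<open>?y'\<close> is not \<open>v\<close> here, so \<open>K\<close> is its
      incompatibility class. The two directions of a trek at \<open>v\<close> are compatible and
      cannot both lie in \<open>K\<close>, so \<open>f\<close>, the number of ends in
      \<open>K\<close>, is at most \<open>visits\<close>.\<close>
    define K where "K = {z. \<not> compatible v z ?y'}"
    have K: "?x' \<in> K" "?y' \<in> K" "?x \<notin> K" "?y \<notin> K"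
      using incomp xy by (auto simp: K_def compatible_def)
    define f where "f p = (\<Sum>z\<in>K. dir_count v z p)" for p
    have f: "f (p, q) = (if v \<in> set (path p q)
        then of_bool (toward v p \<in> K) + of_bool (toward v q \<in> K) else 0)" for p q
      by (simp add: f_def dir_count_def sum.distrib of_bool_def)
    have f_le: "f (p, q) \<le> visits v (p, q)" if "is_trek p q" for p q
    proof (cases "v \<in> set (path p q)")
      case True
      then have "compatible v (toward v p) (toward v q)"
        using that by (intro trek_via_compatible) (simp add: trek_via_def)
      then have "\<not> (toward v p \<in> K \<and> toward v q \<in> K)"
        using incompatible_trans[of v "toward v p" ?y' "toward v q"] compatible_commute
        by (auto simp: K_def)
      then show ?thesis by (simp add: f visits_def)
    qed (simp add: f)
    have f_sum: "(\<Sum>p\<in>#M. f p) = (\<Sum>z\<in>K. \<Sum>p\<in>#M. dir_count v z p)" for M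
      by (induction M) (simp_all add: f_def sum.distrib)
    have f_le': "(\<Sum>p\<in>#M. f p) \<le> (\<Sum>p\<in>#M. visits v p)" if "all_treks M" for M
      using that by (intro sum_mset_mono) (auto simp: all_treks_def f_le)
    \<comment> \<open>The trek from \<open>i\<close> to \<open>j\<close> has no end in
      \<open>K\<close>, so the bound is strict, and equal exponents carry this over to the other
      monomial.\<close>
    have "(\<Sum>p\<in>#add_mset (i, j) N. f p) < (\<Sum>p\<in>#add_mset (i, j) N. visits v p)"
      using f_le'[of N] good(1) K(3,4) on by (simp add: f visits_def)
    then have less: "(\<Sum>p\<in>#add_mset (i, b) M. f p) < (\<Sum>p\<in>#add_mset (i, b) M. visits v p)"
      unfolding f_sum sum_dir_count_cong[OF good eq] sum_visits_cong[OF good eq] .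
    \<comment> \<open>Both known treks have exactly one end in \<open>K\<close>, so the deficit
      comes from a third trek in \<open>R\<close>.\<close>
    have "f (i, b) = visits v (i, b)" "f (k, l) = visits v (k, l)" "f (l, k) = visits v (l, k)"
      using K on kl(4,5) path_rev[of l k] by (auto simp: f visits_def trek_via_def)
    then have "\<exists>p\<in>#R. f p < visits v p"
    proof -
      assume e: "f (i, b) = visits v (i, b)" "f (k, l) = visits v (k, l)" "f (l, k) = visits v (l, k)"
      then have "(\<Sum>p\<in>#R. f p) < (\<Sum>p\<in>#R. visits v p)" using less kl(1) by auto
      then show ?thesis using sum_mset_mono[of R "visits v" f] by (meson leD leI)
    qed
    then obtain z w where zw: "(z, w) \<in># R" "f (z, w) < visits v (z, w)" by auto
    then obtain R' where R': "R = add_mset (z, w) R'" by (meson mset_add)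
    have zw_via: "trek_via v z w"
      using zw R R' by (cases "v \<in> set (path z w)") (auto simp: visits_def trek_via_def)
    have zwK: "toward v z \<notin> K" "toward v w \<notin> K"
      using zw zw_via by (auto simp: f visits_def trek_via_def split: if_splits)
    \<comment> \<open>By transitivity \<open>?x\<close> cannot be incompatible with both directions
      of a trek, so the third trek is turned to fit.\<close>
    have "\<exists>z w. trek_via v z w \<and> toward v z \<notin> K \<and> toward v w \<notin> K \<and> compatible v ?x (toward v w) \<and>
        \<sigma>_monom R = \<sigma>_monom (add_mset (z, w) R')"
    proof (cases "compatible v ?x (toward v w)")
      case True
      then show ?thesis using zw_via zwK R' by blast
    next
      case False
      then have "compatible v ?x (toward v z)"
        using incompatible_trans[of v "toward v z" ?x "toward v w"] compatible_commute
          trek_via_compatible[OF zw_via] by blast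
      then show ?thesis
        using zw_via zwK R' trek_via_commute[of v z w] \<sigma>_commute[of z w]
        by (intro exI[of _ w] exI[of _ z]) simp
    qed
    then obtain z w where zw: "trek_via v z w" "toward v z \<notin> K" "toward v w \<notin> K"
      "compatible v ?x (toward v w)" "\<sigma>_monom R = \<sigma>_monom (add_mset (z, w) R')" by blast
    have R'': "all_treks R'" "all_treks (add_mset (k, l) R')" using R R' kl(2) by simp_all
    have zb: "compatible v (toward v z) ?y'" using zw(2) by (simp add: K_def)
    have kw: "compatible v ?x' (toward v w)"
      using zw(3) incompatible_trans[of v "toward v w" ?x' ?y'] incomp compatible_commute
      by (auto simp: K_def)
    \<comment> \<open>The detour: first \<open>b\<close> and \<open>w\<close> are exchanged, which
      parks \<open>w\<close> at \<open>i\<close>, then \<open>w\<close> and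
      \<open>l\<close>.\<close>
    note step1 = exchange[OF via(2) zw(1) zw(4) zb R''(2)]
    have all: "all_treks (add_mset (z, b) R')" using step1(3) R''(1) by (simp add: trek_via_def)
    have il: "compatible v ?x (toward v l)" using xy kl(5) by simp
    note step2 = exchange[OF step1(2) kl(4) il kw all]
    have e1: "\<sigma>_monom (add_mset (i, b) M) =
        \<sigma>_monom (add_mset (i, b) (add_mset (z, w) (add_mset (k, l) R')))"
      using kl(3) zw(5) by (simp add: mult_ac)
    have e2: "\<sigma>_monom (add_mset (i, w) (add_mset (z, b) (add_mset (k, l) R'))) =
        \<sigma>_monom (add_mset (i, w) (add_mset (k, l) (add_mset (z, b) R')))"
      by (simp add: mult_ac)
    have "\<sigma>_monom (add_mset (i, b) M) -
        \<sigma>_monom (add_mset (i, l) (add_mset (k, w) (add_mset (z, b) R'))) \<in> tetrad_ideal"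
      by (rule ideal_gen_diff_trans[OF step1(1)[folded e1, unfolded e2] step2(1)])
    then show ?thesis
      using that[of l "add_mset (k, w) (add_mset (z, b) R')"] step2 kl(5) by simp
  qed
qed

text \<open>Induction along the path: a trek from \<open>i\<close> that leaves vertex number
  \<open>m\<close> in the right direction also visits the next vertex, where \<open>redirect\<close>
  corrects its direction.\<close>

lemma extract_trek_prefix:
  assumes "all_treks (add_mset (i, j) N)" "all_treks M" "exponent (add_mset (i, j) N) = exponent M"
    and "m < length (path i j)"
  obtains c R where "all_treks (add_mset (i, c) R)" "\<sigma>_monom M - \<sigma>_monom (add_mset (i, c) R) \<in> tetrad_ideal"
    "trek_via (path i j ! m) i c" "toward (path i j ! m) c = toward (path i j ! m) j"
proof -
  have ij: "is_trek i j" using assms(1) by simp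
  have redir: "\<exists>c R. all_treks (add_mset (i, c) R) \<and> \<sigma>_monom M - \<sigma>_monom (add_mset (i, c) R) \<in> tetrad_ideal \<and>
      trek_via v i c \<and> toward v c = toward v j"
    if v: "v \<in> set (path i j)"
      and bR: "all_treks (add_mset (i, b) R)" "\<sigma>_monom M - \<sigma>_monom (add_mset (i, b) R) \<in> tetrad_ideal" "trek_via v i b"
    for v b R
  proof -
    have "exponent (add_mset (i, j) N) = exponent (add_mset (i, b) R)"
      using assms(3) exponent_cong[OF assms(2) bR(1,2)] by simp
    then obtain c R' where "all_treks (add_mset (i, c) R')"
      "\<sigma>_monom (add_mset (i, b) R) - \<sigma>_monom (add_mset (i, c) R') \<in> tetrad_ideal"
      "trek_via v i c" "toward v c = toward v j"
      using redirect[OF assms(1) bR(1)] v ij bR(3) unfolding trek_via_def by metis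
    then show ?thesis using ideal_gen_diff_trans[OF bR(2)] by blast
  qed
  have "\<exists>c R. all_treks (add_mset (i, c) R) \<and> \<sigma>_monom M - \<sigma>_monom (add_mset (i, c) R) \<in> tetrad_ideal \<and>
      trek_via (path i j ! m) i c \<and> toward (path i j ! m) c = toward (path i j ! m) j"
    using assms(4)
  proof (induction m)
    case 0
    have i: "path i j ! 0 = i" using hd_conv_nth[OF path_simps(1), of i j] by simp
    \<comment> \<open>Direction \<open>i\<close> at \<open>i\<close> counts trek ends at
      \<open>i\<close>, so some trek of \<open>M\<close> ends there.\<close>
    have "0 < (\<Sum>p\<in>#M. dir_count i i p)"
      using sum_dir_count_cong[OF assms(1-3), of i i] by (simp add: dir_count_def)
    then obtain k l R where "all_treks (add_mset (k, l) R)" "\<sigma>_monom M = \<sigma>_monom (add_mset (k, l) R)"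
      "trek_via i k l" "toward i l = i"
      using dir_count_posE[OF _ assms(2)] by metis
    then have "all_treks (add_mset (i, k) R)" "\<sigma>_monom M = \<sigma>_monom (add_mset (i, k) R)"
      "trek_via i i k"
      using is_trek_commute[of k l] \<sigma>_commute[of k l] trek_via_commute[of i k l] by auto
    then show ?case using redir[of i k R] unfolding i by simp
  next
    case (Suc m)
    let ?v = "path i j ! m" and ?w = "path i j ! Suc m"
    obtain c R where cR: "all_treks (add_mset (i, c) R)" "\<sigma>_monom M - \<sigma>_monom (add_mset (i, c) R) \<in> tetrad_ideal"
      "trek_via ?v i c" "toward ?v c = toward ?v j"
      using Suc by auto
    have w: "toward ?v c = ?w" using cR(4) toward_nth[OF Suc.prems] by simp
    have "?v \<noteq> ?w" using Suc.prems path_simps(4)[of i j] by (simp add: nth_eq_iff_index_eq)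
    obtain as bs where p: "path i c = as @ ?v # bs" "path ?v c = ?v # bs"
      using cR(3) unfolding trek_via_def by (meson path_decomp)
    have "?w \<in> set bs" using w p(2) \<open>?v \<noteq> ?w\<close> by (cases bs) (auto simp: toward_def)
    then have "trek_via ?w i c" using cR(3) p(1) by (simp add: trek_via_def)
    then show ?case using redir[OF nth_mem[OF Suc.prems] cR(1,2)] by blast
  qed
  then show ?thesis using that by blast
qed

text \<open>At the last vertex the desired direction is \<open>j\<close> itself, which forces the
  trek to end there.\<close>

lemma extract_trek:
  assumes "all_treks (add_mset (i, j) N)" "all_treks M" "exponent (add_mset (i, j) N) = exponent M"
  obtains R where "all_treks (add_mset (i, j) R)" "\<sigma>_monom M - \<sigma>_monom (add_mset (i, j) R) \<in> tetrad_ideal"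
proof -
  let ?m = "length (path i j) - 1"
  have m: "?m < length (path i j)" "path i j ! ?m = j"
    using path_simps(1,3)[of i j] by (simp, metis last_conv_nth)
  obtain c R where "all_treks (add_mset (i, c) R)"
    "\<sigma>_monom M - \<sigma>_monom (add_mset (i, c) R) \<in> tetrad_ideal" "toward (path i j ! ?m) c = toward (path i j ! ?m) j"
    using extract_trek_prefix[OF assms m(1)] .
  then have "c = j" using m(2) by simp
  then show ?thesis using that[of R] \<open>all_treks (add_mset (i, c) R)\<close>
      \<open>\<sigma>_monom M - \<sigma>_monom (add_mset (i, c) R) \<in> tetrad_ideal\<close> by simp
qed

lemma trek_exponent_nonzero: "trek_exponent p \<noteq> 0"
proof -
  obtain i j where "p = (i, j)" by force
  then have "Poly_Mapping.lookup (trek_exponent p) (Avar (top_vertex E (path i j))) = 1"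
    by (simp add: lookup_trek_exponent)
  then show ?thesis by auto
qed

lemma fibre_connected:
  assumes "all_treks M" "all_treks N" "exponent M = exponent N"
  shows "\<sigma>_monom M - \<sigma>_monom N \<in> tetrad_ideal"
  using assms
proof (induction N arbitrary: M)
  case empty
  \<comment> \<open>Every trek contributes the variable of its top, so only the empty monomial has
    exponent \<open>0\<close>.\<close>
  have "M = {#}"
  proof (cases M)
    case (add p M')
    then have "Poly_Mapping.lookup (trek_exponent p) q = 0" for q
      using empty.prems(3) by (metis add_is_0 exponent_simps lookup_add lookup_zero)
    then show ?thesis using trek_exponent_nonzero[of p] by (metis poly_mapping_eqI lookup_zero)
  qed
  then show ?case by simp
next
  case (add p N)
  obtain i j where p: "p = (i, j)" by force
  obtain R where R: "all_treks (add_mset (i, j) R)" "\<sigma>_monom M - \<sigma>_monom (add_mset (i, j) R) \<in> tetrad_ideal"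
    using extract_trek[of i j N M] add.prems p by metis
  have "exponent (add_mset (i, j) R) = exponent (add_mset (i, j) N)"
    using exponent_cong[OF add.prems(1) R] add.prems(3) p by simp
  then have "exponent R = exponent N" by simp
  then have "\<sigma>_monom R - \<sigma>_monom N \<in> tetrad_ideal" using add R p by simp
  then have "\<sigma> i j * (\<sigma>_monom R - \<sigma>_monom N) \<in> tetrad_ideal" by (rule ideal_gen_mult)
  then have "\<sigma>_monom (add_mset (i, j) R) - \<sigma>_monom (add_mset (i, j) N) \<in> tetrad_ideal"
    by (simp add: right_diff_distrib)
  then show ?case using ideal_gen_diff_trans[OF R(2)] p by blast
qed

lemma \<sigma>_monom_not_trek:
  assumes "\<not> all_treks M"
  shows "\<sigma>_monom M \<in> tetrad_ideal"
proof -
  obtain i j R where "M = add_mset (i, j) R" "\<not> is_trek i j"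
    using assms unfolding all_treks_def by (auto dest: multi_member_split)
  moreover from this have "\<sigma> i j \<in> tetrad_ideal" by (intro ideal_gen_incl) (auto simp: trek_gens_def)
  ultimately show ?thesis using ideal_gen_mult[of "\<sigma> i j" trek_gens "\<sigma>_monom R"]
    by (simp add: mult.commute)
qed

section \<open>From monomials to the whole kernel\<close>

lemma single_eq_\<sigma>_monom: "\<exists>M. Poly_Mapping.single m 1 = \<sigma>_monom M"
proof (induction "\<Sum>x\<in>UNIV. Poly_Mapping.lookup m x" arbitrary: m)
  case 0
  then have "m = 0" by (intro poly_mapping_eqI) simp
  then show ?case by (intro exI[of _ "{#}"]) simp
next
  case (Suc n)
  then have "\<exists>x. Poly_Mapping.lookup m x \<noteq> 0" by (metis Zero_not_Suc sum.neutral)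
  then obtain x where x: "Poly_Mapping.lookup m x \<noteq> 0" by blast
  obtain i j where ij: "x = Upair i j" by (cases x) auto
  have "m = Poly_Mapping.single x 1 + (m - Poly_Mapping.single x 1)"
    by (rule poly_mapping_eqI) (use x in \<open>auto simp: lookup_add lookup_minus lookup_single when_def\<close>)
  then obtain m' where m: "m = Poly_Mapping.single x 1 + m'" by blast
  have "(\<Sum>x\<in>UNIV. Poly_Mapping.lookup m x) = 1 + (\<Sum>x\<in>UNIV. Poly_Mapping.lookup m' x)"
    by (simp add: m lookup_add sum.distrib lookup_single when_def)
  then have "n = (\<Sum>x\<in>UNIV. Poly_Mapping.lookup m' x)" using Suc.hyps(2) by simp
  then obtain M where M: "Poly_Mapping.single m' 1 = \<sigma>_monom M" using Suc.hyps(1) by blast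
  then have "Poly_Mapping.single m 1 = \<sigma>_monom (add_mset (i, j) M)"
    by (simp add: m \<sigma>_def Var_def ij mult_single flip: One_nat_def M)
  then show ?case by blast
qed

text \<open>A linear section of \<open>phi\<close> up to \<open>tetrad_ideal\<close>: every monomial in the image is sent to one chosen
  monomial over it.\<close>

definition lift_monom :: "('v param \<Rightarrow>\<^sub>0 nat) \<Rightarrow> 'v uprod cpoly" where
  "lift_monom \<mu> = \<sigma>_monom (SOME M. all_treks M \<and> exponent M = \<mu>)"

definition lift :: "'v param cpoly \<Rightarrow> 'v uprod cpoly" where
  "lift g = (\<Sum>\<mu>\<in>Poly_Mapping.keys g. Const (Poly_Mapping.lookup g \<mu>) * lift_monom \<mu>)"

lemma lift_superset:
  assumes "finite X" "Poly_Mapping.keys g \<subseteq> X"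
  shows "lift g = (\<Sum>\<mu>\<in>X. Const (Poly_Mapping.lookup g \<mu>) * lift_monom \<mu>)"
  unfolding lift_def
  by (rule sum.mono_neutral_left) (use assms in \<open>auto simp: in_keys_iff\<close>)

lemma lift_0 [simp]: "lift 0 = 0"
  by (simp add: lift_def)

lemma lift_add: "lift (g + h) = lift g + lift h"
  using Poly_Mapping.keys_add[of g h]
  by (simp add: lift_superset[of "Poly_Mapping.keys g \<union> Poly_Mapping.keys h"] lookup_add Const_add
      distrib_right sum.distrib)

lemma lift_sum: "lift (sum g A) = (\<Sum>x\<in>A. lift (g x))"
  by (induction A rule: infinite_finite_induct) (simp_all add: lift_add)

text \<open>A monomial with a non-trek factor lies in the ideal and is sent to \<open>0\<close>; any
  other differs from the chosen representative of its fibre by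
  \<open>fibre_connected\<close>.\<close>

lemma lift_phi_single: "Poly_Mapping.single m c - lift (phi E (Poly_Mapping.single m c)) \<in> tetrad_ideal"
proof -
  obtain M where M: "Poly_Mapping.single m 1 = \<sigma>_monom M" using single_eq_\<sigma>_monom by blast
  have m: "Poly_Mapping.single m c = Const c * \<sigma>_monom M"
    by (simp add: Const_def mult_single flip: M)
  have phi: "phi E (Poly_Mapping.single m c) = Const c * phi E (\<sigma>_monom M)"
    by (simp add: m phi.hom_mult) (simp add: phi_def poly_subst_Const)
  show ?thesis
  proof (cases "all_treks M")
    case False
    then have "\<sigma>_monom M \<in> tetrad_ideal" by (rule \<sigma>_monom_not_trek)
    moreover from this have "phi E (\<sigma>_monom M) = 0" using phi_eq_mod_tetrad_ideal[of "\<sigma>_monom M" 0] by simp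
    ultimately have "lift (phi E (Poly_Mapping.single m c)) = 0" "Const c * \<sigma>_monom M \<in> tetrad_ideal"
      unfolding phi by (simp_all add: ideal_gen_mult)
    then show ?thesis using m by simp
  next
    case True
    define N where "N = (SOME N. all_treks N \<and> exponent N = exponent M)"
    have N: "all_treks N \<and> exponent N = exponent M"
      unfolding N_def by (rule someI[of _ M]) (simp add: True)
    have "phi E (Poly_Mapping.single m c) = Poly_Mapping.single (exponent M) c"
      by (simp add: phi phi_\<sigma>_monom[OF True] Const_def mult_single)
    then have "lift (phi E (Poly_Mapping.single m c)) = Const c * \<sigma>_monom N"
      by (simp add: lift_superset[of "{exponent M}"] lift_monom_def N_def)
    then show ?thesis
      using ideal_gen_mult[OF fibre_connected[OF True, of N], of "Const c"] N m
      by (simp add: right_diff_distrib)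
  qed
qed

text \<open>Composing \<open>phi\<close> with \<open>lift\<close> is additive and the identity
  modulo \<open>tetrad_ideal\<close> on each term, so \<open>f\<close> is congruent to
  \<open>lift 0 = 0\<close>.\<close>

lemma trek_ideal_subset_tetrad_ideal: "trek_ideal E \<subseteq> tetrad_ideal"
proof
  fix f assume "f \<in> trek_ideal E"
  then have "phi E f = 0" by (simp add: trek_ideal_def)
  let ?s = "\<lambda>m. Poly_Mapping.single m (Poly_Mapping.lookup f m)"
  have f: "f = (\<Sum>m\<in>Poly_Mapping.keys f. ?s m)" by (rule cpoly_sum_monomials)
  have "(\<Sum>m\<in>Poly_Mapping.keys f. lift (phi E (?s m))) = lift (phi E (\<Sum>m\<in>Poly_Mapping.keys f. ?s m))"
    by (simp add: phi.hom_sum lift_sum)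
  also have "\<dots> = 0" using \<open>phi E f = 0\<close> f by simp
  finally have "f = (\<Sum>m\<in>Poly_Mapping.keys f. ?s m - lift (phi E (?s m)))"
    using f by (simp add: sum_subtractf)
  also have "\<dots> \<in> tetrad_ideal" by (intro ideal_gen_sum lift_phi_single)
  finally show "f \<in> tetrad_ideal" .
qed

end

theorem theorem5p8:
  fixes E :: "('v::{finite,linorder} \<times> 'v) set"
  assumes "numerically_ordered E"
    and "is_tree E"
  shows "trek_ideal E = ci_ideal E \<and>
    (\<exists>S \<subseteq> {\<sigma> i j | i j. True} \<union> {tetrad i j k l | i j k l. True}.
      trek_ideal E = ideal_gen S)"
proof -
  interpret ordered_tree E
    using assms by unfold_locales (auto simp: is_tree_def)
  have "tetrad_ideal \<subseteq> ci_ideal E" "ci_ideal E \<subseteq> trek_ideal E" "trek_ideal E \<subseteq> tetrad_ideal"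
    using tetrad_ideal_subset_ci_ideal ci_ideal_subset_trek_ideal[OF ordered acyclic] trek_ideal_subset_tetrad_ideal by auto
  moreover have "trek_gens \<subseteq> {\<sigma> i j | i j. True} \<union> {tetrad i j k l | i j k l. True}"
    unfolding trek_gens_def by blast
  ultimately show ?thesis by blast
qed

end
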